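(* Let $\alpha\in[0,1)$ be a fixed constant, and let $c\in\mathbb{N}$, $\varepsilon\in(0,1-\alpha)$, $\gamma\in(0,1-\alpha]$ and $K>0$ be arbitrary constants. Let $m=m(n)\ge 1$ be a sequence of integers with $m=o(\log n)$. Then, with probability $1-o(1)$ as $n\to\infty$ over the random graph $G\sim\mathcal{G}(n,\frac12,k=\lfloor n^\alpha\rfloor)$ with planted clique $\mathcal{PC}$, the following holds. For every monotone (nondecreasing) $1$-Lipschitz $h:[n]\to\mathbb{R}$ with $h_0=0$, all inverse temperatures $\beta_0<\beta_1<\dots<\beta_m$ with $\max_i|\beta_i|\le K$, and all positive estimates $\widehat Z(\beta_0)<\widehat Z(\beta_1)<\dots<\widehat Z(\beta_m)$, the simulated tempering (ST) dynamics $\{(X_t,I_t)\}$ starting from $(\emptyset,0)$ will, with probability $1-n^{-\omega(1)}$, not reach within $n^c$ steps a pair of clique and temperature where (i) either the clique is of size at least $(1+\varepsilon)\log n$, (ii) or the clique is of intersection at least $\gamma\log n$ with the planted clique.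
   Context: Conventions: $\log$ is the base-2 logarithm; $[n]=\{0,1,\dots,n\}$. $n^{-\omega(1)}$ denotes a quantity that is at most $n^{-D}$ for every constant $D>0$ once $n$ is large enough. Planted clique model: $\mathcal{G}(n,\frac12,k)$ is the random graph on an $n$-element vertex set $V$ obtained by sampling $\mathcal{G}(n,\frac12)$ (each pair is an edge independently with probability $1/2$), choosing a uniformly random $k$-subset $\mathcal{PC}\subseteq V$ (the planted clique), and adding all edges between vertices of $\mathcal{PC}$. $\Omega(G)$ denotes the set of all cliques of $G$, i.e. vertex subsets (including $\emptyset$) whose vertices are pairwise adjacent. "$h$ is $1$-Lipschitz" means $|h_q-h_{q'}|\le|q-q'|$ for all $q,q'\in[n]$ with $q,q'\le2.1\log n$, where $h_q=h(q)$. ST dynamics: given $h$, inverse temperatures $\beta_0<\dots<\beta_m$, positive numbers $\widehat Z(\beta_i)$ (thought of as estimates of the partition functions $Z(\beta_i)=\sum_{C\in\Omega(G)}\exp(\beta_i h_{|C|})$) and a fixed parameter $a\in(0,1)$, this is the Markov chain $\{(X_t,I_t)\}$ on $\Omega(G)\times\{0,1,\dots,m\}$ with transition probabilities: (level move) for $C,C'\in\Omega(G)$ differing in exactly one vertex, $P((C,i),(C',i))=\frac{a}{n}\min\{1,\exp[\beta_i(h_{|C'|}-h_{|C|})]\}$; (temperature move) for $|i-i'|=1$, $P((C,i),(C,i'))=\frac{1-a}{2}\min\{1,\frac{\widehat Z(\beta_i)}{\widehat Z(\beta_{i'})}\exp[(\beta_{i'}-\beta_i)h_{|C|}]\}$;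 and the remaining probability is put on staying at the current state. *)

theory Defs
  imports
    "HOL-Probability.Probability"
    "HOL-Library.Landau_Symbols"
    "HOL-Library.Ramsey"
begin

text \<open>Graphs on the vertex set \<open>{..<n}\<close> are given by their edge sets, which are subsets of
  \<open>nsets {..<n} 2\<close>.\<close>

definition random_graph :: "nat \<Rightarrow> nat set set pmf" where
  "random_graph n =
     map_pmf (\<lambda>f. {e \<in> nsets {..<n} 2. f e})
       (Pi_pmf (nsets {..<n} 2) False (\<lambda>_. bernoulli_pmf (1/2)))"

text \<open>The joint law of the edge set and of the planted clique. It is only meaningful for
  \<open>k \<le> n\<close>, as \<^const>\<open>pmf_of_set\<close> needs a nonempty set.\<close>

definition planted_clique :: "nat \<Rightarrow> nat \<Rightarrow> (nat set set \<times> nat set) pmf" where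
  "planted_clique n k =
     bind_pmf (random_graph n) (\<lambda>E.
     bind_pmf (pmf_of_set (nsets {..<n} k)) (\<lambda>S.
     return_pmf (E \<union> nsets S 2, S)))"

definition cliques :: "nat \<Rightarrow> nat set set \<Rightarrow> nat set set" where
  "cliques n E = {C. C \<subseteq> {..<n} \<and> clique C E}"

definition lipschitz1 :: "nat \<Rightarrow> (nat \<Rightarrow> real) \<Rightarrow> bool" where
  "lipschitz1 n h \<longleftrightarrow>
     (\<forall>q \<le> n. \<forall>q' \<le> n. real q \<le> 2.1 * log 2 (real n) \<longrightarrow> real q' \<le> 2.1 * log 2 (real n) \<longrightarrow>
        \<bar>h q - h q'\<bar> \<le> \<bar>real q - real q'\<bar>)"

definition superpoly_small :: "(nat \<Rightarrow> real) \<Rightarrow> bool" where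
  "superpoly_small \<delta> \<longleftrightarrow> (\<forall>D>0. eventually (\<lambda>n. \<delta> n \<le> real n powr (-D)) sequentially)"

definition st_states :: "nat \<Rightarrow> nat set set \<Rightarrow> nat \<Rightarrow> (nat set \<times> nat) set" where
  "st_states n E m = cliques n E \<times> {0..m}"

text \<open>The temperature indexed by \<open>i\<close> is \<open>\<beta> i\<close>, and \<open>Z i\<close> is the estimate of the partition
  function at \<open>\<beta> i\<close>. Only \<open>i \<le> m\<close> matters.\<close>

definition st_move ::
  "nat \<Rightarrow> nat set set \<Rightarrow> (nat \<Rightarrow> real) \<Rightarrow> nat \<Rightarrow> (nat \<Rightarrow> real) \<Rightarrow> (nat \<Rightarrow> real) \<Rightarrow> real \<Rightarrow>
   nat set \<times> nat \<Rightarrow> nat set \<times> nat \<Rightarrow> real" where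
  "st_move n E h m \<beta> Z a = (\<lambda>(C, i) (C', i').
     if (C, i) \<in> st_states n E m \<and> (C', i') \<in> st_states n E m then
       (if i' = i \<and> card (sym_diff C C') = 1
        then a / real n * min 1 (exp (\<beta> i * (h (card C') - h (card C))))
        else if C' = C \<and> \<bar>int i - int i'\<bar> = 1
        then (1 - a) / 2 * min 1 (Z i / Z i' * exp ((\<beta> i' - \<beta> i) * h (card C)))
        else 0)
     else 0)"

definition st_prob ::
  "nat \<Rightarrow> nat set set \<Rightarrow> (nat \<Rightarrow> real) \<Rightarrow> nat \<Rightarrow> (nat \<Rightarrow> real) \<Rightarrow> (nat \<Rightarrow> real) \<Rightarrow> real \<Rightarrow>
   nat set \<times> nat \<Rightarrow> nat set \<times> nat \<Rightarrow> real" where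
  "st_prob n E h m \<beta> Z a s s' =
     (if s' = s then 1 - (\<Sum>u \<in> st_states n E m - {s}. st_move n E h m \<beta> Z a s u)
      else st_move n E h m \<beta> Z a s s')"

text \<open>That \<open>st_prob\<close> is a stochastic matrix, so that \<^const>\<open>embed_pmf\<close> is used legitimately, is
  \<open>pmf_st_kernel\<close> below.\<close>

definition st_kernel ::
  "nat \<Rightarrow> nat set set \<Rightarrow> (nat \<Rightarrow> real) \<Rightarrow> nat \<Rightarrow> (nat \<Rightarrow> real) \<Rightarrow> (nat \<Rightarrow> real) \<Rightarrow> real \<Rightarrow>
   nat set \<times> nat \<Rightarrow> (nat set \<times> nat) pmf" where
  "st_kernel n E h m \<beta> Z a s = embed_pmf (st_prob n E h m \<beta> Z a s)"

text \<open>The law of the trajectory \<open>[X\<^sub>0, \<dots>, X\<^sub>T]\<close> of the Markov chain with kernel \<open>K\<close>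
  started at \<open>X\<^sub>0 = s\<close>.\<close>

primrec trajectory :: "('s \<Rightarrow> 's pmf) \<Rightarrow> nat \<Rightarrow> 's \<Rightarrow> 's list pmf" where
  "trajectory K 0 s = return_pmf [s]"
| "trajectory K (Suc T) s = bind_pmf (K s) (\<lambda>s'. map_pmf ((#) s) (trajectory K T s'))"

lemma finite_st_states: "finite (st_states n E m)"
  unfolding st_states_def cliques_def by (auto intro: finite_subset[of _ "Pow {..<n}"])

lemma st_move_nonneg:
  assumes "0 \<le> a" "a \<le> 1" "\<And>i. i \<le> m \<Longrightarrow> Z i > 0"
  shows "st_move n E h m \<beta> Z a s s' \<ge> 0"
proof (cases s; cases s')
  fix C i C' i' assume s: "s = (C, i)" "s' = (C', i')"
  have "0 \<le> (1 - a) / 2 * min 1 (Z i / Z i' * exp ((\<beta> i' - \<beta> i) * h (card C)))"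
    if "i \<le> m" "i' \<le> m"
  proof -
    have "0 \<le> Z i / Z i' * exp ((\<beta> i' - \<beta> i) * h (card C))"
      using assms(3)[OF that(1)] assms(3)[OF that(2)] by simp
    then have "0 \<le> min 1 (Z i / Z i' * exp ((\<beta> i' - \<beta> i) * h (card C)))" by simp
    then show ?thesis using assms(2) by (intro mult_nonneg_nonneg) auto
  qed
  moreover have "0 \<le> a / real n * min 1 (exp (\<beta> i * (h (card C') - h (card C))))"
    using assms(1) by (intro mult_nonneg_nonneg) auto
  ultimately show ?thesis
    unfolding s st_move_def prod.case st_states_def by (simp only: mem_Times_iff split: if_split) simp
qed

lemma sum_st_move_le:
  assumes a: "0 \<le> a" "a \<le> 1" and Z: "\<And>i. i \<le> m \<Longrightarrow> Z i > 0"
  shows "(\<Sum>u \<in> st_states n E m - {s}. st_move n E h m \<beta> Z a s u) \<le> 1"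
proof -
  obtain C i where s: "s = (C, i)" by (cases s)
  define L where "L = (\<lambda>v. (sym_diff C {v}, i)) ` {..<n}"
  define T where "T = {(C, i + 1), (C, i - 1)}"
  have fin: "finite L" "finite T" unfolding L_def T_def by auto
  have card: "card L \<le> n" "card T \<le> 2"
    unfolding L_def T_def using card_image_le[of "{..<n}"] by (auto simp: card_insert_if)
  have bound: "st_move n E h m \<beta> Z a s u \<le>
      (if u \<in> L then a / real n else 0) + (if u \<in> T then (1 - a) / 2 else 0)" for u
  proof -
    obtain C' i' where u: "u = (C', i')" by (cases u)
    consider (lev) "C \<subseteq> {..<n}" "C' \<subseteq> {..<n}" "i' = i" "card (sym_diff C C') = 1"
        "st_move n E h m \<beta> Z a s u = a / real n * min 1 (exp (\<beta> i * (h (card C') - h (card C))))"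
      | (temp) "C' = C" "\<bar>int i - int i'\<bar> = 1"
        "st_move n E h m \<beta> Z a s u =
           (1 - a) / 2 * min 1 (Z i / Z i' * exp ((\<beta> i' - \<beta> i) * h (card C)))"
      | (none) "st_move n E h m \<beta> Z a s u = 0"
    proof (cases "(C, i) \<in> st_states n E m \<and> (C', i') \<in> st_states n E m")
      case True
      then have sub: "C \<subseteq> {..<n}" "C' \<subseteq> {..<n}" unfolding st_states_def cliques_def by auto
      show thesis
      proof (cases "i' = i \<and> card (sym_diff C C') = 1")
        case l: True
        then show thesis using sub True by (intro lev) (simp_all add: s u st_move_def)
      next
        case l: False
        show thesis
        proof (cases "C' = C \<and> \<bar>int i - int i'\<bar> = 1")
          case t: True
          then show thesis using True by (intro temp) (simp_all add: s u st_move_def)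
        next
          case t: False
          show thesis by (rule none) (use l t in \<open>simp only: s u st_move_def prod.case if_False if_cancel\<close>)
        qed
      qed
    next
      case False
      then show thesis by (intro none) (simp only: s u st_move_def prod.case if_False)
    qed
    then show ?thesis
    proof cases
      case lev
      from lev(4) obtain v where v: "sym_diff C C' = {v}" by (auto simp: card_1_singleton_iff)
      have "v < n" using v lev(1,2) by blast
      moreover have "C' = sym_diff C {v}" using v by blast
      ultimately have "u \<in> L" unfolding L_def u lev(3) by blast
      moreover have "st_move n E h m \<beta> Z a s u \<le> a / real n"
        unfolding lev(5) using a by (intro mult_left_le) auto
      moreover have "0 \<le> (1 - a) / 2" "0 \<le> a / real n" using a by auto
      ultimately show ?thesis by (cases "u \<in> L"; cases "u \<in> T"; simp only: if_True if_False; linarith)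
    next
      case temp
      have "i' = i + 1 \<or> i' = i - 1" using temp(2) by linarith
      then have "u \<in> T" unfolding T_def u temp(1) by auto
      moreover have "st_move n E h m \<beta> Z a s u \<le> (1 - a) / 2"
        unfolding temp(3) using a by (intro mult_left_le) auto
      moreover have "0 \<le> (1 - a) / 2" "0 \<le> a / real n" using a by auto
      ultimately show ?thesis by (cases "u \<in> L"; cases "u \<in> T"; simp only: if_True if_False; linarith)
    qed (use a in auto)
  qed
  have "(\<Sum>u \<in> st_states n E m - {s}. st_move n E h m \<beta> Z a s u) \<le>
      (\<Sum>u \<in> st_states n E m - {s}.
        (if u \<in> L then a / real n else 0) + (if u \<in> T then (1 - a) / 2 else 0))"
    by (intro sum_mono bound)
  also have "\<dots> = real (card ((st_states n E m - {s}) \<inter> L)) * (a / real n) +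
      real (card ((st_states n E m - {s}) \<inter> T)) * ((1 - a) / 2)"
    using finite_st_states[of n E m] by (simp add: sum.distrib sum.If_cases Int_def)
  also have "\<dots> \<le> real n * (a / real n) + 2 * ((1 - a) / 2)"
  proof -
    have "card ((st_states n E m - {s}) \<inter> L) \<le> n"
      using card_mono[OF fin(1), of "(st_states n E m - {s}) \<inter> L"] card(1) by auto
    moreover have "card ((st_states n E m - {s}) \<inter> T) \<le> 2"
      using card_mono[OF fin(2), of "(st_states n E m - {s}) \<inter> T"] card(2) by auto
    ultimately show ?thesis using a by (intro add_mono mult_right_mono) auto
  qed
  also have "\<dots> \<le> 1" using a by (cases "n = 0") (auto simp: field_simps)
  finally show ?thesis .
qed

lemma pmf_st_kernel:
  assumes a: "0 \<le> a" "a \<le> 1" and Z: "\<And>i. i \<le> m \<Longrightarrow> Z i > 0"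
  shows "pmf (st_kernel n E h m \<beta> Z a s) s' = st_prob n E h m \<beta> Z a s s'"
  unfolding st_kernel_def
proof (rule pmf_embed_pmf)
  let ?P = "st_prob n E h m \<beta> Z a s" and ?S = "st_states n E m"
  show nonneg: "0 \<le> ?P u" for u
    unfolding st_prob_def
    using st_move_nonneg[OF a, of m Z] sum_st_move_le[OF a, of m Z] Z by auto
  have fin: "finite (insert s ?S)" using finite_st_states by simp
  have out: "?P u = 0" if "u \<notin> insert s ?S" for u
    using that by (cases s; cases u) (auto simp: st_prob_def st_move_def)
  have "(\<integral>\<^sup>+u. ennreal (?P u) \<partial>count_space UNIV) = (\<Sum>u\<in>insert s ?S. ennreal (?P u))"
    using out by (intro nn_integral_count_space'[OF fin]) auto
  also have "\<dots> = ennreal (\<Sum>u\<in>insert s ?S. ?P u)"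
    using nonneg by (intro sum_ennreal) auto
  also have "(\<Sum>u\<in>insert s ?S. ?P u) = ?P s + (\<Sum>u\<in>?S - {s}. ?P u)"
    using finite_st_states[of n E m] by (simp add: sum.insert_remove)
  also have "(\<Sum>u\<in>?S - {s}. ?P u) = (\<Sum>u\<in>?S - {s}. st_move n E h m \<beta> Z a s u)"
    by (intro sum.cong) (auto simp: st_prob_def)
  finally show "(\<integral>\<^sup>+u. ennreal (?P u) \<partial>count_space UNIV) = 1"
    by (simp add: st_prob_def)
qed

end

(* By reversibility the law of the chain at time t, divided by the stationary weight, evolves under
   the kernel itself, so it stays below any approximately superharmonic function that starts above
   it. Every clique of size q < (1 - eta) log n has about n / 2^q extensions, hence at every
   temperature the size drifts upwards there, up to the constant factor exp K. Thus returning from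
   size log n to the empty clique costs a factor of about 2^((log n)^2 / 2). To do damage the chain
   must visit a clique whose size or whose intersection with the planted clique equals its threshold,
   and by a first moment bound such cliques, weighted by the cost of descending from them, number
   only about 2^((1/2 - kappa) (log n)^2). The temperature weights contribute polynomial factors
   only, because the estimates Z increase and h is bounded by the size. *)

theory Submission
  imports Defs "HOL-Real_Asymp.Real_Asymp"
begin

section \<open>Reversible chains and hitting probabilities\<close>

text \<open>The drift estimate cannot be used up to the threshold size: near log n a clique may have
  few or no extensions. The potential is therefore cut off at a size \<open>Q\<close> of about (1 -
  \<eta>) log n and is flat beyond it. The price is an additive error per step, the last increment
  of the potential. Over polynomially many steps this error stays comparable with the potential
  itself, up to a factor 2 to the O(\<eta> (log n)^2). To leading order the number of cliques of
  size log n is exactly balanced by the cost of descending from them, so the whole margin \<kappa>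
  comes from the thresholds. An excess of \<epsilon> log n in size gains \<epsilon>^2 / 2, and
  \<gamma> log n planted vertices gain at least \<gamma> (1 - \<alpha>) / 2. The planted clique
  destroys independence of the edges. It is handled by fixing it first and counting common
  neighbours in the unplanted graph, which planting can only enlarge. The resulting good event
  speaks of the graph alone, so it serves all \<open>h\<close>, \<beta> and \<open>Z\<close>
  simultaneously. The potential depends on the clique size only, so temperature moves do not affect
  it.\<close>

definition nstep :: "('s \<Rightarrow> 's pmf) \<Rightarrow> nat \<Rightarrow> 's \<Rightarrow> 's pmf" where
  "nstep K t s = ((\<lambda>p. bind_pmf p K) ^^ t) (return_pmf s)"

lemma nstep_0 [simp]: "nstep K 0 s = return_pmf s"
  by (simp add: nstep_def)

lemma nstep_Suc: "nstep K (Suc t) s = bind_pmf (nstep K t s) K"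
  by (simp add: nstep_def)

text \<open>The reversibility induction pushes the law forward by a last step, whereas
  \<open>trajectory\<close> unfolds its first step; this reconciles the two.\<close>

lemma nstep_Suc_left: "nstep K (Suc t) s = bind_pmf (K s) (nstep K t)"
proof (induction t)
  case 0
  then show ?case
    by (simp add: nstep_Suc bind_return_pmf bind_return_pmf' nstep_0[abs_def])
next
  case (Suc t)
  have "nstep K (Suc (Suc t)) s = bind_pmf (bind_pmf (K s) (nstep K t)) K"
    by (subst nstep_Suc) (simp only: Suc)
  also have "\<dots> = bind_pmf (K s) (nstep K (Suc t))"
    by (simp add: bind_assoc_pmf nstep_Suc[abs_def])
  finally show ?case .
qed

lemma set_pmf_nstep_subset:
  assumes "\<And>u. u \<in> S \<Longrightarrow> set_pmf (K u) \<subseteq> S" "s \<in> S"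
  shows "set_pmf (nstep K t s) \<subseteq> S"
  using assms(2) by (induction t) (use assms(1) in \<open>auto simp: nstep_Suc\<close>)

lemma prob_bind_pmf:
  "measure_pmf.prob (bind_pmf p f) A = (\<integral>x. measure_pmf.prob (f x) A \<partial>measure_pmf p)"
proof -
  have "ennreal (measure_pmf.prob (bind_pmf p f) A) = (\<integral>\<^sup>+x. ennreal (measure_pmf.prob (f x) A) \<partial>measure_pmf p)"
    by (simp add: measure_pmf.emeasure_eq_measure[symmetric])
  also have "\<dots> = ennreal (\<integral>x. measure_pmf.prob (f x) A \<partial>measure_pmf p)"
    by (intro nn_integral_eq_integral measure_pmf.integrable_const_bound[of _ 1]) auto
  finally show ?thesis
    by (simp add: integral_nonneg)
qed

lemma integrable_prob_pmf: "integrable (measure_pmf p) (\<lambda>x. measure_pmf.prob (f x) A)"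
  by (rule measure_pmf.integrable_const_bound[of _ 1]) auto

text \<open>\<open>B\<close> contains every point at which \<open>A\<close> can be entered, so a
  trajectory meeting \<open>A\<close> is in \<open>B\<close> at its first visit. The bound is the
  union over that time. It matters because the boundary \<open>B\<close> is far easier to count than
  \<open>A\<close>.\<close>

lemma prob_trajectory_hit_le:
  assumes cross: "\<And>x y. x \<notin> A \<Longrightarrow> y \<in> set_pmf (K x) \<Longrightarrow> y \<in> A \<Longrightarrow> y \<in> B"
    and "s \<in> A \<Longrightarrow> s \<in> B"
  shows "measure_pmf.prob (trajectory K T s) {xs. \<exists>x\<in>set xs. x \<in> A}
    \<le> (\<Sum>t\<le>T. measure_pmf.prob (nstep K t s) B)"
  using assms(2)
proof (induction T arbitrary: s)
  case 0
  then show ?case by (auto simp: indicator_def)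
next
  case (Suc T)
  have split: "(\<Sum>t\<le>Suc T. measure_pmf.prob (nstep K t s) B)
      = indicator B s + (\<Sum>t\<le>T. measure_pmf.prob (nstep K (Suc t) s) B)"
    unfolding sum.atMost_Suc_shift by simp
  show ?case
  proof (cases "s \<in> A")
    case True
    then have "s \<in> B" using Suc.prems by auto
    have "measure_pmf.prob (trajectory K (Suc T) s) {xs. \<exists>x\<in>set xs. x \<in> A} \<le> 1"
      by (rule measure_pmf.prob_le_1)
    moreover have "0 \<le> (\<Sum>t\<le>T. measure_pmf.prob (nstep K (Suc t) s) B)"
      by (intro sum_nonneg) auto
    ultimately show ?thesis unfolding split indicator_simps(1)[OF \<open>s \<in> B\<close>] by linarith
  next
    case False
    have "measure_pmf.prob (trajectory K (Suc T) s) {xs. \<exists>x\<in>set xs. x \<in> A}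
        = (\<integral>y. measure_pmf.prob (trajectory K T y) {xs. \<exists>x\<in>set xs. x \<in> A} \<partial>measure_pmf (K s))"
      using False by (simp add: prob_bind_pmf vimage_def)
    also have "\<dots> \<le> (\<integral>y. (\<Sum>t\<le>T. measure_pmf.prob (nstep K t y) B) \<partial>measure_pmf (K s))"
    proof (rule integral_mono_AE)
      show "AE y in measure_pmf (K s). measure_pmf.prob (trajectory K T y) {xs. \<exists>x\<in>set xs. x \<in> A}
          \<le> (\<Sum>t\<le>T. measure_pmf.prob (nstep K t y) B)"
        using cross[OF False] by (intro AE_pmfI Suc.IH) auto
    qed (intro integrable_prob_pmf Bochner_Integration.integrable_sum)+
    also have "\<dots> = (\<Sum>t\<le>T. measure_pmf.prob (nstep K (Suc t) s) B)"
      by (subst Bochner_Integration.integral_sum)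
        (auto intro!: integrable_prob_pmf simp: nstep_Suc_left prob_bind_pmf)
    also have "\<dots> \<le> (\<Sum>t\<le>Suc T. measure_pmf.prob (nstep K t s) B)"
      unfolding split by simp
    finally show ?thesis .
  qed
qed

text \<open>Detailed balance turns the forward equation for the law into the backward equation for
  its density with respect to \<pi>: the density at time t + 1 at \<open>u\<close> is the average of
  the density at time t under \<open>K u\<close>. An almost superharmonic \<phi> that dominates the
  initial density, up to the factor \<open>\<pi> s\<close>, thus keeps dominating it, with
  \<open>d\<close> lost per step.\<close>

lemma pmf_nstep_le_reversible:
  assumes fin: "finite S" and s: "s \<in> S"
    and closed: "\<And>u. u \<in> S \<Longrightarrow> set_pmf (K u) \<subseteq> S"
    and pos: "\<And>u. u \<in> S \<Longrightarrow> \<pi> u > 0"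
    and rev: "\<And>u w. u \<in> S \<Longrightarrow> w \<in> S \<Longrightarrow> \<pi> u * pmf (K u) w = \<pi> w * pmf (K w) u"
    and super: "\<And>u. u \<in> S \<Longrightarrow> (\<Sum>w\<in>S. pmf (K u) w * \<phi> w) \<le> \<phi> u + d"
    and nonneg: "\<And>u. u \<in> S \<Longrightarrow> \<phi> u \<ge> 0" and start: "\<phi> s \<ge> 1" 
    and "u \<in> S"
  shows "pmf (nstep K t s) u \<le> \<pi> u / \<pi> s * (\<phi> u + real t * d)"
  using \<open>u \<in> S\<close>
proof (induction t arbitrary: u)
  case 0
  then show ?case using start nonneg pos[OF s] pos[OF 0]
    by (cases "u = s") (auto simp: pmf_return)
next
  case (Suc t)
  have one: "(\<Sum>w\<in>S. pmf (K u) w) = 1"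
    using closed[OF Suc.prems] fin by (simp add: sum_pmf_eq_1)
  have "pmf (nstep K (Suc t) s) u = (\<integral>w. pmf (K w) u \<partial>measure_pmf (nstep K t s))"
    by (simp add: nstep_Suc pmf_bind)
  also have "\<dots> = (\<Sum>w\<in>S. pmf (nstep K t s) w * pmf (K w) u)"
    using set_pmf_nstep_subset[where K = K, OF closed s, of t]
    by (subst integral_measure_pmf[OF fin]) auto
  also have "\<dots> \<le> (\<Sum>w\<in>S. \<pi> w / \<pi> s * (\<phi> w + real t * d) * pmf (K w) u)"
    by (intro sum_mono mult_right_mono Suc.IH) auto
  also have "\<dots> = (\<Sum>w\<in>S. (\<pi> w * pmf (K w) u) / \<pi> s * (\<phi> w + real t * d))"
    by (intro sum.cong) auto
  also have "\<dots> = (\<Sum>w\<in>S. (\<pi> u * pmf (K u) w) / \<pi> s * (\<phi> w + real t * d))"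
    by (intro sum.cong refl) (simp add: rev Suc.prems)
  also have "\<dots> = \<pi> u / \<pi> s * ((\<Sum>w\<in>S. pmf (K u) w * \<phi> w) + real t * d * (\<Sum>w\<in>S. pmf (K u) w))"
    by (simp add: sum_distrib_left sum_distrib_right sum.distrib algebra_simps sum_divide_distrib add_divide_distrib)
  also have "\<dots> \<le> \<pi> u / \<pi> s * ((\<phi> u + d) + real t * d * 1)"
    unfolding one using pos[OF s] pos[OF Suc.prems]
    by (intro mult_left_mono add_right_mono super Suc.prems) auto
  finally show ?case by (simp add: algebra_simps)
qed

section \<open>Drift of the simulated tempering chain\<close>

text \<open>The reversible measure up to normalisation. Dividing each Gibbs weight by its estimate
  makes both acceptance probabilities Metropolis ratios of this weight.\<close>

definition st_weight :: "(nat \<Rightarrow> real) \<Rightarrow> (nat \<Rightarrow> real) \<Rightarrow> (nat \<Rightarrow> real) \<Rightarrow> nat set \<times> nat \<Rightarrow> real" where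
  "st_weight h \<beta> Z = (\<lambda>(C, i). exp (\<beta> i * h (card C)) / Z i)"

lemma st_move_commute:
  assumes Z: "\<And>i. i \<le> m \<Longrightarrow> Z i > 0"
  shows "st_weight h \<beta> Z u * st_move n E h m \<beta> Z a u w = st_weight h \<beta> Z w * st_move n E h m \<beta> Z a w u"
proof -
  obtain C i C' i' where u: "u = (C, i)" and w: "w = (C', i')" by (cases u; cases w)
  have metropolis: "x * (c * min 1 (y / x)) = y * (c * min 1 (x / y))" if "x > 0" "y > 0" for x y c :: real
    using that by (simp add: min_def field_simps)
  have sd: "sym_diff C C' = sym_diff C' C" by blast
  show ?thesis
  proof (cases "u \<in> st_states n E m \<and> w \<in> st_states n E m")
    case True
    then have i: "i \<le> m" "i' \<le> m" by (auto simp: u w st_states_def)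
    then have Zi: "Z i > 0" "Z i' > 0" using Z by auto
    let ?x = "st_weight h \<beta> Z u" and ?y = "st_weight h \<beta> Z w"
    have pos: "?x > 0" "?y > 0" using Zi by (auto simp: u w st_weight_def)
    show ?thesis
    proof (cases "i' = i \<and> card (sym_diff C C') = 1")
      case lev: True
      have q: "exp (\<beta> i * (h (card C') - h (card C))) = ?y / ?x"
          "exp (\<beta> i * (h (card C) - h (card C'))) = ?x / ?y"
        using lev Zi by (auto simp: u w st_weight_def right_diff_distrib exp_diff)
      have "st_move n E h m \<beta> Z a u w = a / real n * min 1 (?y / ?x)"
        "st_move n E h m \<beta> Z a w u = a / real n * min 1 (?x / ?y)"
        using lev True sd unfolding q[symmetric] by (auto simp: u w st_move_def)
      then show ?thesis
        using metropolis[OF pos] by (simp only:)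
    next
      case nlev: False
      show ?thesis
      proof (cases "C' = C \<and> \<bar>int i - int i'\<bar> = 1")
        case temp: True
        have q: "Z i / Z i' * exp ((\<beta> i' - \<beta> i) * h (card C)) = ?y / ?x"
            "Z i' / Z i * exp ((\<beta> i - \<beta> i') * h (card C')) = ?x / ?y"
          using temp Zi by (auto simp: u w st_weight_def left_diff_distrib exp_diff)
        have "i' \<noteq> i" "\<bar>int i' - int i\<bar> = 1" using temp by auto
        then have "st_move n E h m \<beta> Z a u w = (1 - a) / 2 * min 1 (?y / ?x)"
          "st_move n E h m \<beta> Z a w u = (1 - a) / 2 * min 1 (?x / ?y)"
          using temp True unfolding q[symmetric] by (auto simp: u w st_move_def)
        then show ?thesis
          using metropolis[OF pos] by (simp only:)
      next
        case ntemp: False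
        then have "\<not> (C = C' \<and> \<bar>int i' - int i\<bar> = 1)" by auto
        moreover have "\<not> (i = i' \<and> card (sym_diff C' C) = 1)" using nlev sd by auto
        ultimately have "st_move n E h m \<beta> Z a u w = 0" "st_move n E h m \<beta> Z a w u = 0"
          using nlev ntemp by (simp_all only: u w st_move_def prod.case if_False if_cancel)
        then show ?thesis by simp
      qed
    qed
  next
    case False
    then have "st_move n E h m \<beta> Z a u w = 0" "st_move n E h m \<beta> Z a w u = 0"
      by (auto simp: u w st_move_def)
    then show ?thesis by simp
  qed
qed

lemma st_kernel_reversible:
  assumes "0 \<le> a" "a \<le> 1" "\<And>i. i \<le> m \<Longrightarrow> Z i > 0"
  shows "st_weight h \<beta> Z u * pmf (st_kernel n E h m \<beta> Z a u) w =
    st_weight h \<beta> Z w * pmf (st_kernel n E h m \<beta> Z a w) u"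
proof (cases "u = w")
  case False
  then show ?thesis
    using st_move_commute[of m Z h \<beta> u n E a w] assms
    by (simp add: pmf_st_kernel st_prob_def)
qed simp

lemma set_pmf_st_kernel:
  assumes "0 \<le> a" "a \<le> 1" "\<And>i. i \<le> m \<Longrightarrow> Z i > 0"
    and "w \<in> set_pmf (st_kernel n E h m \<beta> Z a u)"
  shows "w = u \<or> u \<in> st_states n E m \<and> w \<in> st_states n E m \<and>
    (fst w = fst u \<or> card (sym_diff (fst u) (fst w)) = 1)"
proof (cases "w = u")
  case False
  obtain C i C' i' where u: "u = (C, i)" and w: "w = (C', i')" by (cases u; cases w)
  have "st_move n E h m \<beta> Z a u w \<noteq> 0"
    using assms False by (simp add: set_pmf_iff pmf_st_kernel st_prob_def)
  then show ?thesis
    unfolding u w st_move_def prod.case fst_conv by (meson)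
qed simp

text \<open>As \<phi> is antimonotone, removals raise it and insertions lower it. Each removal is
  therefore given its largest possible rate a / n, and each insertion its smallest, a b / n.
  Temperature moves preserve the size and drop out.\<close>

lemma st_kernel_drift:
  fixes \<phi> :: "nat \<Rightarrow> real"
  assumes a: "0 \<le> a" "a \<le> 1" and Z: "\<And>i. i \<le> m \<Longrightarrow> Z i > 0"
    and C: "C \<in> cliques n E" and i: "i \<le> m" and \<phi>: "antimono \<phi>" and b: "0 \<le> b" "b \<le> 1"
    and up: "\<phi> (Suc (card C)) \<noteq> \<phi> (card C) \<Longrightarrow> b \<le> exp (\<beta> i * (h (Suc (card C)) - h (card C)))"
  shows "(\<Sum>w\<in>st_states n E m. pmf (st_kernel n E h m \<beta> Z a (C, i)) w * \<phi> (card (fst w)))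
    \<le> \<phi> (card C) + a / real n * (real (card C) * (\<phi> (card C - 1) - \<phi> (card C))
        - b * real (card {v \<in> {..<n} - C. insert v C \<in> cliques n E}) * (\<phi> (card C) - \<phi> (Suc (card C))))"
proof -
  define u where "u = (C, i)"
  define q where "q = card C"
  define S where "S = st_states n E m"
  define X where "X = {v \<in> {..<n} - C. insert v C \<in> cliques n E}"
  define D where "D = \<phi> (q - 1) - \<phi> q"
  define U where "U = \<phi> q - \<phi> (Suc q)"
  define dn where "dn = (\<lambda>v. (C - {v}, i)) ` C"
  define xt where "xt = (\<lambda>v. (insert v C, i)) ` X"
  define f where "f = (\<lambda>w. st_move n E h m \<beta> Z a u w * (\<phi> (card (fst w)) - \<phi> q))"
  have finC: "finite C" and sub: "C \<subseteq> {..<n}"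
    using C finite_subset[of C "{..<n}"] by (auto simp: cliques_def)
  have finS: "finite S" unfolding S_def by (rule finite_st_states)
  have finX: "finite X" unfolding X_def by auto
  have uS: "u \<in> S" using C i by (auto simp: u_def S_def st_states_def)
  have D0: "D \<ge> 0" and U0: "U \<ge> 0" unfolding D_def U_def using \<phi> by (auto simp: antimono_def)
  have dnS: "dn \<subseteq> S - {u}"
    using C i by (auto simp: dn_def S_def st_states_def cliques_def u_def intro: smaller_clique)
  have xtS: "xt \<subseteq> S - {u}"
    using i by (auto simp: xt_def X_def S_def st_states_def u_def)
  have "(\<Sum>w\<in>S. pmf (st_kernel n E h m \<beta> Z a u) w * \<phi> (card (fst w)))
      = (\<Sum>w\<in>S. st_prob n E h m \<beta> Z a u w * \<phi> (card (fst w)))"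
    by (simp add: pmf_st_kernel[OF a Z])
  also have "\<dots> = st_prob n E h m \<beta> Z a u u * \<phi> q
      + (\<Sum>w\<in>S - {u}. st_prob n E h m \<beta> Z a u w * \<phi> (card (fst w)))"
    using finS uS by (simp add: sum.remove u_def q_def)
  also have "(\<Sum>w\<in>S - {u}. st_prob n E h m \<beta> Z a u w * \<phi> (card (fst w)))
      = (\<Sum>w\<in>S - {u}. st_move n E h m \<beta> Z a u w * \<phi> (card (fst w)))"
    by (intro sum.cong) (auto simp: st_prob_def)
  also have "st_prob n E h m \<beta> Z a u u = 1 - (\<Sum>w\<in>S - {u}. st_move n E h m \<beta> Z a u w)"
    by (simp add: st_prob_def S_def)
  also have "(1 - (\<Sum>w\<in>S - {u}. st_move n E h m \<beta> Z a u w)) * \<phi> q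
      + (\<Sum>w\<in>S - {u}. st_move n E h m \<beta> Z a u w * \<phi> (card (fst w))) = \<phi> q + (\<Sum>w\<in>S - {u}. f w)"
    by (simp add: f_def algebra_simps sum_subtractf sum_distrib_left sum_distrib_right)
  \<comment> \<open>Outside \<open>dn\<close> and \<open>xt\<close> a state is either unreachable in
    one move or has the same clique, where the increment of \<phi> is zero.\<close>
  also have "(\<Sum>w\<in>S - {u}. f w) = (\<Sum>w\<in>dn \<union> xt. f w)"
  proof (rule sum.mono_neutral_right)
    show "\<forall>w\<in>S - {u} - (dn \<union> xt). f w = 0"
    proof
      fix w assume w: "w \<in> S - {u} - (dn \<union> xt)"
      obtain C' i' where w': "w = (C', i')" by (cases w)
      have C': "C' \<in> cliques n E" using w by (auto simp: w' S_def st_states_def)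
      have "\<not> (i' = i \<and> card (sym_diff C C') = 1)"
      proof
        assume lev: "i' = i \<and> card (sym_diff C C') = 1"
        then obtain v where v: "sym_diff C C' = {v}" by (auto simp: card_1_singleton_iff)
        have mem: "(x \<in> C \<and> x \<notin> C' \<or> x \<in> C' \<and> x \<notin> C) = (x = v)" for x
          using arg_cong[OF v, of "\<lambda>A. x \<in> A"] by simp
        show False
        proof (cases "v \<in> C")
          case True
          then have "C' = C - {v}" using True by (intro set_eqI) (metis mem Diff_iff singleton_iff)
          then have "w \<in> dn" using True lev by (auto simp: dn_def w')
          then show False using w by simp
        next
          case False
          then have "C' = insert v C" using False by (intro set_eqI) (metis mem insert_iff)
          moreover have "v < n" using C' mem[of v] False by (auto simp: cliques_def)
          ultimately have "w \<in> xt" using False lev C' by (auto simp: xt_def X_def w')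
          then show False using w by simp
        qed
      qed
      then have lev0: "(i' = i \<and> card (sym_diff C C') = 1) = False" by blast
      show "f w = 0"
      proof (cases "C' = C")
        case True
        then show ?thesis by (simp add: f_def w' q_def)
      next
        case False
        then have "(C' = C \<and> \<bar>int i - int i'\<bar> = 1) = False" by blast
        then have "st_move n E h m \<beta> Z a u w = 0"
          by (simp only: u_def w' st_move_def prod.case lev0 if_False if_cancel)
        then show ?thesis by (simp add: f_def)
      qed
    qed
  qed (use finS dnS xtS in auto)
  also have "\<dots> = (\<Sum>w\<in>dn. f w) + (\<Sum>w\<in>xt. f w)"
    by (rule sum.union_disjoint) (use finC finX in \<open>auto simp: dn_def xt_def X_def\<close>)
  also have "(\<Sum>w\<in>dn. f w) \<le> real (card dn) * (a / real n * D)"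
  proof (rule sum_bounded_above)
    fix w assume wd: "w \<in> dn"
    then obtain v where v: "v \<in> C" "w = (C - {v}, i)" by (auto simp: dn_def)
    have "sym_diff C (C - {v}) = {v}" using v by blast
    moreover have "w \<in> S" using dnS wd by auto
    ultimately have "st_move n E h m \<beta> Z a u w \<le> a / real n"
      using uS a by (auto simp: v u_def st_move_def S_def intro!: mult_left_le divide_right_mono)
    then have "st_move n E h m \<beta> Z a u w * D \<le> a / real n * D"
      using D0 by (rule mult_right_mono)
    moreover have "card (fst w) = q - 1" using v finC by (simp add: q_def)
    ultimately show "f w \<le> a / real n * D"
      by (simp add: f_def D_def)
  qed
  also have "\<dots> \<le> real q * (a / real n * D)"
    using D0 a finC by (intro mult_right_mono) (auto simp: dn_def q_def intro: card_image_le)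
  also have "(\<Sum>w\<in>xt. f w) \<le> real (card xt) * (- (a / real n * b * U))"
  proof (rule sum_bounded_above)
    fix w assume wd: "w \<in> xt"
    then obtain v where v: "v \<in> X" "w = (insert v C, i)" by (auto simp: xt_def)
    then have vC: "v \<notin> C" by (auto simp: X_def)
    have cw: "card (fst w) = Suc q" using v vC finC by (simp add: q_def)
    show "f w \<le> - (a / real n * b * U)"
    \<comment> \<open>The lower bound \<open>b\<close> on the acceptance is granted only where
      \<phi> changes; where it is flat the term vanishes anyway.\<close>
    proof (cases "U = 0")
      case True
      then show ?thesis using cw by (simp add: f_def U_def)
    next
      case False
      have "sym_diff C (insert v C) = {v}" using vC by blast
      moreover have "w \<in> S" using xtS wd by auto
      ultimately have "st_move n E h m \<beta> Z a u w
          = a / real n * min 1 (exp (\<beta> i * (h (Suc q) - h q)))"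
        using uS cw by (simp add: v u_def st_move_def S_def q_def)
      moreover have "b \<le> min 1 (exp (\<beta> i * (h (Suc q) - h q)))"
        using b up False by (simp add: q_def U_def)
      ultimately have "a / real n * b \<le> st_move n E h m \<beta> Z a u w"
        using mult_left_mono[of b "min 1 (exp (\<beta> i * (h (Suc q) - h q)))" "a / real n"] a by simp
      then have "a / real n * b * U \<le> st_move n E h m \<beta> Z a u w * U"
        using U0 by (rule mult_right_mono)
      then show ?thesis by (simp add: f_def cw U_def algebra_simps)
    qed
  qed
  also have "card xt = card X"
    unfolding xt_def by (rule card_image) (auto simp: inj_on_def X_def)
  finally show ?thesis
    by (simp add: q_def D_def U_def X_def u_def S_def algebra_simps)
qed

section \<open>The gambler's-ruin potential\<close>

text \<open>The increments \<open>descent b M j\<close> of the potential are products of the ratios of downward to upward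
  rates, as in gambler's ruin: the chain leaves size \<open>i\<close> downwards at rate at most \<open>a i / n\<close> and
  upwards at rate at least \<open>a b M i / n\<close>. The potential is therefore superharmonic except at size
  \<open>Q\<close>, where the error is at most the last increment.\<close>

definition descent :: "real \<Rightarrow> (nat \<Rightarrow> real) \<Rightarrow> nat \<Rightarrow> real" where
  "descent b M j = (\<Prod>i\<in>{1..<j}. real i / (b * M i))"

definition potential :: "real \<Rightarrow> (nat \<Rightarrow> real) \<Rightarrow> nat \<Rightarrow> nat \<Rightarrow> real" where
  "potential b M Q q = (\<Sum>j\<in>{q<..Q}. descent b M j)"

context
  fixes b :: real and M :: "nat \<Rightarrow> real"
  assumes b: "0 < b" and M: "\<And>i. 0 < M i"
begin

lemma descent_nonneg: "descent b M j \<ge> 0"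
  unfolding descent_def using b M by (intro prod_nonneg) (simp add: less_imp_le)

lemma descent_Suc: "1 \<le> j \<Longrightarrow> b * M j * descent b M (Suc j) = real j * descent b M j"
  unfolding descent_def using b M[of j] by (simp add: prod.atLeastLessThan_Suc)

lemma potential_diff: "q < Q \<Longrightarrow> potential b M Q q - potential b M Q (Suc q) = descent b M (Suc q)"
proof -
  assume "q < Q"
  then have "{q<..Q} = insert (Suc q) {Suc q<..Q}" by auto
  then show ?thesis unfolding potential_def by simp
qed

lemma potential_eq_0: "Q \<le> q \<Longrightarrow> potential b M Q q = 0"
  unfolding potential_def by simp

lemma potential_nonneg: "potential b M Q q \<ge> 0"
  unfolding potential_def by (intro sum_nonneg descent_nonneg)

lemma antimono_potential: "antimono (potential b M Q)"
  unfolding potential_def by (intro antimonoI sum_mono2) (auto simp: descent_nonneg)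

text \<open>The increment at j = 1 is an empty product. This normalisation lets the potential
  dominate the initial density at the empty clique.\<close>

lemma potential_0_ge_1:
  assumes "1 \<le> Q"
  shows "1 \<le> potential b M Q 0"
proof -
  have "1 = descent b M 1" by (simp add: descent_def)
  also have "\<dots> \<le> potential b M Q 0"
    unfolding potential_def using assms by (intro member_le_sum) (auto simp: descent_nonneg)
  finally show ?thesis .
qed

text \<open>Since h 0 = 0, the start has weight \<open>1 / Z 0\<close>, whence the prefactor. The
  parameter \<open>a\<close> disappears because it multiplies the upward and downward rates alike
  and is at most 1 in the error term.\<close>

lemma pmf_nstep_st_kernel_le:
  assumes a: "0 \<le> a" "a \<le> 1" and Z: "\<And>i. i \<le> m \<Longrightarrow> Z i > 0" and n: "n > 0" and b1: "b \<le> 1"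
    and Q: "1 \<le> Q" "Q \<le> n" and h0: "h 0 = 0"
    and ext: "\<And>C. C \<in> cliques n E \<Longrightarrow> card C < Q \<Longrightarrow>
      M (card C) \<le> real (card {v \<in> {..<n} - C. insert v C \<in> cliques n E})"
    and up: "\<And>i q. i \<le> m \<Longrightarrow> q < Q \<Longrightarrow> b \<le> exp (\<beta> i * (h (Suc q) - h q))"
    and u: "(C, i) \<in> st_states n E m"
  shows "pmf (nstep (st_kernel n E h m \<beta> Z a) t ({}, 0)) (C, i)
    \<le> exp (\<beta> i * h (card C)) * Z 0 / Z i * (potential b M Q (card C) + real t * descent b M Q)"
proof -
  let ?K = "st_kernel n E h m \<beta> Z a" and ?S = "st_states n E m"
  let ?\<phi> = "potential b M Q" and ?D = "descent b M"
  have "pmf (nstep ?K t ({}, 0)) (C, i) \<le> st_weight h \<beta> Z (C, i) / st_weight h \<beta> Z ({}, 0)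
      * (?\<phi> (card (fst (C, i))) + real t * ?D Q)"
  proof (rule pmf_nstep_le_reversible[OF finite_st_states[of n E m]])
    show "({}, 0) \<in> ?S" by (simp add: st_states_def cliques_def)
    show "set_pmf (?K v) \<subseteq> ?S" if "v \<in> ?S" for v
      using set_pmf_st_kernel[OF a Z] that by fast
    show "0 < st_weight h \<beta> Z v" if "v \<in> ?S" for v
      using that Z by (auto simp: st_states_def st_weight_def)
    show "st_weight h \<beta> Z v * pmf (?K v) w = st_weight h \<beta> Z w * pmf (?K w) v" for v w
      by (rule st_kernel_reversible[OF a Z])
    show "(\<Sum>w\<in>?S. pmf (?K v) w * ?\<phi> (card (fst w))) \<le> ?\<phi> (card (fst v)) + ?D Q" if v: "v \<in> ?S" for v
    proof -
      obtain B j where vB: "v = (B, j)" by (cases v)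
      define q where "q = card B"
      define X where "X = real (card {x \<in> {..<n} - B. insert x B \<in> cliques n E})"
      have B: "B \<in> cliques n E" and j: "j \<le> m" using v by (auto simp: vB st_states_def)
      have flat: "?\<phi> (Suc q) = ?\<phi> q" if "Q \<le> q" using that by (simp add: potential_eq_0)
      have "(\<Sum>w\<in>?S. pmf (?K (B, j)) w * ?\<phi> (card (fst w)))
          \<le> ?\<phi> q + a / real n * (real q * (?\<phi> (q - 1) - ?\<phi> q) - b * X * (?\<phi> q - ?\<phi> (Suc q)))"
        unfolding q_def X_def
        by (rule st_kernel_drift[OF a Z B j antimono_potential])
          (use b b1 up[OF j, of q] flat in \<open>auto simp: q_def not_less[symmetric]\<close>)
      also have "a / real n * (real q * (?\<phi> (q - 1) - ?\<phi> q) - b * X * (?\<phi> q - ?\<phi> (Suc q))) \<le> ?D Q"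
      proof (cases "q < Q")
        case True
        \<comment> \<open>Balance below \<open>Q\<close>: what removals add is repaid by insertions.
          At q = 0 the truncated \<open>q - 1\<close> is harmless, being multiplied by q.\<close>
        have "real q * (?\<phi> (q - 1) - ?\<phi> q) = real q * ?D q"
          using potential_diff[of "q - 1" Q] True by (cases "q = 0") auto
        also have "\<dots> \<le> b * M q * ?D (Suc q)"
          using descent_Suc[of q] b M[of q] descent_nonneg[of "Suc q"] by (cases "q = 0") auto
        also have "\<dots> \<le> b * X * ?D (Suc q)"
          using ext[OF B] True b by (intro mult_right_mono mult_left_mono descent_nonneg) (auto simp: q_def X_def)
        also have "\<dots> = b * X * (?\<phi> q - ?\<phi> (Suc q))"
          by (simp only: potential_diff[OF True])
        finally have "a / real n * (real q * (?\<phi> (q - 1) - ?\<phi> q) - b * X * (?\<phi> q - ?\<phi> (Suc q))) \<le> 0"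
          using a by (intro mult_nonneg_nonpos) auto
        then show ?thesis using descent_nonneg[of Q] by linarith
      next
        case False
        \<comment> \<open>At size \<open>Q\<close> nothing repays the removals, and above it the
          potential is flat. The factor \<open>Q\<close> is then absorbed by a / n, as a \<le> 1 and
          Q \<le> n.\<close>
        have "real q * (?\<phi> (q - 1) - ?\<phi> q) \<le> real Q * ?D Q"
        proof (cases "q = Q")
          case True
          then show ?thesis using potential_diff[of "Q - 1" Q] Q by simp
        next
          case neq: False
          then show ?thesis using False descent_nonneg[of Q] by (simp add: potential_eq_0)
        qed
        moreover have "?\<phi> q - ?\<phi> (Suc q) = 0" using False flat by simp
        ultimately have "a / real n * (real q * (?\<phi> (q - 1) - ?\<phi> q) - b * X * (?\<phi> q - ?\<phi> (Suc q)))
            \<le> a / real n * (real Q * ?D Q)"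
          using a by (intro mult_left_mono) auto
        also have "\<dots> \<le> 1 / real n * (real n * ?D Q)"
          using a Q descent_nonneg[of Q] by (intro mult_mono divide_right_mono mult_right_mono) auto
        finally show ?thesis using n by simp
      qed
      finally show ?thesis by (simp add: vB q_def)
    qed
    show "1 \<le> ?\<phi> (card (fst ({}, 0::nat)))" using potential_0_ge_1[OF Q(1)] by simp
  qed (use u in \<open>auto simp: potential_nonneg\<close>)
  then show ?thesis by (simp add: st_weight_def h0)
qed

text \<open>Union bound over T + 1 times, m + 1 temperatures and the cliques at which the bad set
  can be entered. One vertex changes per step, so neither the size nor the intersection can jump
  over its threshold. \<open>R\<close> absorbs the temperature weights of all cliques up to size
  \<open>x\<close>, which includes the whole boundary.\<close>

lemma prob_st_hit_le:
  fixes x y :: nat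
  assumes a: "0 \<le> a" "a \<le> 1" and Z: "\<And>i. i \<le> m \<Longrightarrow> Z i > 0" and n: "n > 0" and b1: "b \<le> 1"
    and Q: "1 \<le> Q" "Q \<le> n" and h0: "h 0 = 0"
    and ext: "\<And>C. C \<in> cliques n E \<Longrightarrow> card C < Q \<Longrightarrow>
      M (card C) \<le> real (card {v \<in> {..<n} - C. insert v C \<in> cliques n E})"
    and up: "\<And>i q. i \<le> m \<Longrightarrow> q < Q \<Longrightarrow> b \<le> exp (\<beta> i * (h (Suc q) - h q))"
    and xy: "1 \<le> x" "1 \<le> y"
    and R: "\<And>i q. i \<le> m \<Longrightarrow> q \<le> x \<Longrightarrow> exp (\<beta> i * h q) * Z 0 / Z i \<le> R"
  shows "measure_pmf.prob (trajectory (st_kernel n E h m \<beta> Z a) T ({}, 0))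
      {xs. \<exists>(C, i)\<in>set xs. x \<le> card C \<or> y \<le> card (C \<inter> S)}
    \<le> (real T + 1) * (real m + 1) * R *
      (\<Sum>C\<in>{C \<in> cliques n E. card C \<le> x \<and> card (C \<inter> S) \<le> y \<and> (card C = x \<or> card (C \<inter> S) = y)}.
        potential b M Q (card C) + real T * descent b M Q)"
proof -
  let ?K = "st_kernel n E h m \<beta> Z a"
  define F where "F = {C \<in> cliques n E. card C \<le> x \<and> card (C \<inter> S) \<le> y \<and> (card C = x \<or> card (C \<inter> S) = y)}"
  define A where "A = {(C, i::nat). x \<le> card C \<or> y \<le> card (C \<inter> S)}"
  define pt where "pt = (\<lambda>C :: nat set. potential b M Q (card C) + real T * descent b M Q)"
  have finF: "finite F"
    unfolding F_def cliques_def by (rule finite_subset[of _ "Pow {..<n}"]) auto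
  have pt0: "pt C \<ge> 0" for C
    unfolding pt_def by (intro add_nonneg_nonneg mult_nonneg_nonneg potential_nonneg descent_nonneg) auto
  have "{xs. \<exists>(C, i)\<in>set xs. x \<le> card C \<or> y \<le> card (C \<inter> S)} = {xs. \<exists>u\<in>set xs. u \<in> A}"
    unfolding A_def by auto
  then have "measure_pmf.prob (trajectory ?K T ({}, 0))
      {xs. \<exists>(C, i)\<in>set xs. x \<le> card C \<or> y \<le> card (C \<inter> S)}
    = measure_pmf.prob (trajectory ?K T ({}, 0)) {xs. \<exists>u\<in>set xs. u \<in> A}" by simp
  also have "\<dots> \<le> (\<Sum>t\<le>T. measure_pmf.prob (nstep ?K t ({}, 0)) (F \<times> {0..m}))"
  proof (rule prob_trajectory_hit_le)
    fix u w assume u: "u \<notin> A" and w: "w \<in> A" and "w \<in> set_pmf (?K u)"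
    from set_pmf_st_kernel[OF a Z this(3)] u w
    have st: "u \<in> st_states n E m" "w \<in> st_states n E m"
      and ch: "fst w = fst u \<or> card (sym_diff (fst u) (fst w)) = 1" by auto
    obtain C i C' i' where uw: "u = (C, i)" "w = (C', i')" by (cases u; cases w)
    from st have C: "C \<in> cliques n E" "C' \<in> cliques n E" "i' \<le> m"
      by (auto simp: uw st_states_def)
    then have fin: "finite C" "finite C'" by (auto simp: cliques_def intro: finite_subset[of _ "{..<n}"])
    \<comment> \<open>A temperature move keeps the clique, and \<open>A\<close> ignores the
      temperature, so an entry into \<open>A\<close> must change one vertex.\<close>
    from ch u w obtain v where v: "sym_diff C C' = {v}"
      by (auto simp: A_def uw card_1_singleton_iff)
    then have sub: "C' \<subseteq> insert v C" by blast
    have "card C' \<le> card (insert v C)" using sub fin by (intro card_mono) auto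
    also have "\<dots> \<le> Suc (card C)" using fin by (simp add: card_insert_if)
    finally have 1: "card C' \<le> Suc (card C)" .
    have "card (C' \<inter> S) \<le> card (insert v (C \<inter> S))" using sub fin by (intro card_mono) auto
    also have "\<dots> \<le> Suc (card (C \<inter> S))" using fin by (simp add: card_insert_if)
    finally have 2: "card (C' \<inter> S) \<le> Suc (card (C \<inter> S))" .
    show "w \<in> F \<times> {0..m}"
      using 1 2 u w C by (auto simp: A_def F_def uw)
  qed (use xy in \<open>simp add: A_def\<close>)
  also have "\<dots> \<le> (\<Sum>t\<le>T. (real m + 1) * R * (\<Sum>C\<in>F. pt C))"
  proof (rule sum_mono)
    fix t assume t: "t \<in> {..T}"
    have "measure_pmf.prob (nstep ?K t ({}, 0)) (F \<times> {0..m})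
        = (\<Sum>u\<in>F \<times> {0..m}. pmf (nstep ?K t ({}, 0)) u)"
      using finF by (intro measure_measure_pmf_finite) auto
    also have "\<dots> \<le> (\<Sum>u\<in>F \<times> {0..m}. R * pt (fst u))"
    proof (rule sum_mono)
      fix u assume "u \<in> F \<times> {0..m}"
      then obtain C i where u: "u = (C, i)" "C \<in> F" "i \<le> m" by auto
      have st: "(C, i) \<in> st_states n E m" using u by (auto simp: F_def st_states_def)
      have "pmf (nstep ?K t ({}, 0)) (C, i) \<le> exp (\<beta> i * h (card C)) * Z 0 / Z i
          * (potential b M Q (card C) + real t * descent b M Q)"
        by (rule pmf_nstep_st_kernel_le[OF a Z n b1 Q h0 ext up st])
      also have "\<dots> \<le> exp (\<beta> i * h (card C)) * Z 0 / Z i * pt C"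
        unfolding pt_def using t Z[of 0] Z[OF u(3)] descent_nonneg
        by (intro mult_left_mono add_left_mono mult_right_mono divide_nonneg_pos) auto
      also have "\<dots> \<le> R * pt C"
        using u by (intro mult_right_mono R pt0) (auto simp: F_def)
      finally show "pmf (nstep ?K t ({}, 0)) u \<le> R * pt (fst u)" by (simp add: u)
    qed
    also have "\<dots> = (real m + 1) * R * (\<Sum>C\<in>F. pt C)"
      by (simp add: sum.cartesian_product' sum_distrib_left mult.assoc add.commute)
    finally show "measure_pmf.prob (nstep ?K t ({}, 0)) (F \<times> {0..m}) \<le> (real m + 1) * R * (\<Sum>C\<in>F. pt C)" .
  qed
  also have "\<dots> = (real T + 1) * (real m + 1) * R * (\<Sum>C\<in>F. pt C)" by (simp add: algebra_simps)
  finally show ?thesis unfolding F_def pt_def .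
qed

end

section \<open>The random graph\<close>

lemma prob_Pi_pmf_bernoulli_all:
  assumes "finite I" "J \<subseteq> I"
  shows "measure_pmf.prob (Pi_pmf I dflt (\<lambda>_. bernoulli_pmf (1/2))) {f. \<forall>e\<in>J. f e} = (1/2) ^ card J"
proof -
  have "{f. \<forall>e\<in>J. f e} = Pi I (\<lambda>e. if e \<in> J then {True} else UNIV)"
    using assms(2) by (auto simp: Pi_def split: if_splits)
  then have "measure_pmf.prob (Pi_pmf I dflt (\<lambda>_. bernoulli_pmf (1/2))) {f. \<forall>e\<in>J. f e}
      = (\<Prod>e\<in>I. if e \<in> J then 1/2 else 1)"
    using assms(1) by (simp add: measure_Pi_pmf_Pi measure_pmf_single if_distrib[of "measure_pmf.prob _"] cong: if_cong)
  also have "\<dots> = (1/2) ^ card J"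
    using assms by (simp add: prod.If_cases Int_absorb1)
  finally show ?thesis .
qed

text \<open>The product is c to the number of blocks that are entirely true, so this is the
  generating function of that number. It factorises because the blocks are disjoint, hence
  independent.\<close>

lemma expectation_Pi_pmf_bernoulli_blocks:
  fixes c :: real
  assumes "finite U" "finite I" "\<And>v. v \<in> U \<Longrightarrow> J v \<subseteq> I" "disjoint_family_on J U"
  shows "measure_pmf.expectation (Pi_pmf I dflt (\<lambda>_. bernoulli_pmf (1/2)))
      (\<lambda>f. \<Prod>v\<in>U. if \<forall>e\<in>J v. f e then c else 1)
    = (\<Prod>v\<in>U. 1 - (1 - c) * (1/2) ^ card (J v))"
proof -
  let ?P = "Pi_pmf I dflt (\<lambda>_. bernoulli_pmf (1/2))"
  let ?g = "\<lambda>v f. if \<forall>e\<in>J v. f e then c else (1::real)"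
  have P: "prob_space (measure_pmf ?P)" by (rule measure_pmf.prob_space_axioms)
  have fJ: "finite (J v)" if "v \<in> U" for v using assms(2,3) that finite_subset by blast
  have "prob_space.indep_vars (measure_pmf ?P) (\<lambda>v. PiM (J v) (\<lambda>_. count_space UNIV))
      (\<lambda>v f. restrict (\<lambda>e. f e) (J v)) U"
    using prob_space.indep_vars_restrict[OF P indep_vars_Pi_pmf[OF assms(2)]] assms(3,4) by blast
  then have "prob_space.indep_vars (measure_pmf ?P) (\<lambda>_. borel) (\<lambda>v f. ?g v (restrict (\<lambda>e. f e) (J v))) U"
  proof (rule prob_space.indep_vars_compose2[OF P])
    fix v assume "v \<in> U"
    have "Measurable.pred (PiM (J v) (\<lambda>_. count_space UNIV)) (\<lambda>f. \<forall>e\<in>J v. f e)"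
      by (intro pred_intros_finite fJ \<open>v \<in> U\<close> measurable_component_singleton)
    then show "?g v \<in> borel_measurable (PiM (J v) (\<lambda>_. count_space UNIV))"
      by measurable
  qed
  then have ind: "prob_space.indep_vars (measure_pmf ?P) (\<lambda>_. borel) ?g U"
    by simp
  have bdd: "\<bar>?g v f\<bar> \<le> max \<bar>c\<bar> 1" for v f by auto
  have int: "integrable (measure_pmf ?P) (?g v)" for v
    by (rule measure_pmf.integrable_const_bound[of _ "max \<bar>c\<bar> 1"]) auto
  have "measure_pmf.expectation ?P (\<lambda>f. \<Prod>v\<in>U. ?g v f) = (\<Prod>v\<in>U. measure_pmf.expectation ?P (?g v))"
    by (rule prob_space.indep_vars_lebesgue_integral[OF P assms(1) ind int])
  also have "\<dots> = (\<Prod>v\<in>U. 1 - (1 - c) * (1/2) ^ card (J v))"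
  proof (rule prod.cong[OF refl])
    fix v assume v: "v \<in> U"
    have "?g v = (\<lambda>f. 1 - (1 - c) * indicat_real {f. \<forall>e\<in>J v. f e} f)"
      by (auto simp: fun_eq_iff indicator_def)
    then have "measure_pmf.expectation ?P (?g v)
        = measure_pmf.expectation ?P (\<lambda>f. 1 - (1 - c) * indicat_real {f. \<forall>e\<in>J v. f e} f)"
      by simp
    also have "\<dots> = 1 - (1 - c) * measure_pmf.prob ?P {f. \<forall>e\<in>J v. f e}"
      by (subst Bochner_Integration.integral_diff)
        (auto intro!: integrable_mult_right measure_pmf.integrable_const_bound[of _ 1])
    finally show "measure_pmf.expectation ?P (?g v) = 1 - (1 - c) * (1/2) ^ card (J v)"
      by (simp add: prob_Pi_pmf_bernoulli_all[OF assms(2) assms(3)[OF v]])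
  qed
  finally show ?thesis .
qed

section \<open>Concentration of the number of common neighbours\<close>

definition common_nbrs :: "nat \<Rightarrow> nat set set \<Rightarrow> nat set \<Rightarrow> nat set" where
  "common_nbrs n E C = {v \<in> {..<n} - C. \<forall>u\<in>C. {u, v} \<in> E}"

lemma finite_edges: "finite (nsets {..<n::nat} 2)"
  by (simp add: finite_imp_finite_nsets)

text \<open>Chernoff bound for the lower tail, with base 1/2: Markov's inequality is applied to 1/2
  to the number of common neighbours. For distinct vertices outside \<open>C\<close> the pairs
  joining them to \<open>C\<close> are disjoint, so this number is binomial, whether or not
  \<open>C\<close> is a clique.\<close>

lemma prob_common_nbrs_less:
  assumes C: "C \<subseteq> {..<n}"
  shows "measure_pmf.prob (random_graph n) {E. real (card (common_nbrs n E C)) < M}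
    \<le> 2 powr M * exp (- (real (n - card C) / (2 * 2 ^ card C)))"
proof -
  define I where "I = nsets {..<n} 2"
  define U where "U = {..<n} - C"
  define J where "J = (\<lambda>v. (\<lambda>u. {u, v}) ` C)"
  let ?P = "Pi_pmf I False (\<lambda>_. bernoulli_pmf (1/2))"
  have finI: "finite I" unfolding I_def by (rule finite_edges)
  have finC: "finite C" using C finite_subset by blast
  have JI: "J v \<subseteq> I" if "v \<in> U" for v
    using that C by (auto simp: J_def I_def U_def)
  have dis: "disjoint_family_on J U"
    by (auto simp: disjoint_family_on_def J_def U_def doubleton_eq_iff)
  have cardJ: "card (J v) = card C" if "v \<in> U" for v
    unfolding J_def by (rule card_image) (auto simp: inj_on_def doubleton_eq_iff)
  have cardU: "card U = n - card C" unfolding U_def using C finC by (simp add: card_Diff_subset)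
  define u where "u = (\<lambda>f. \<Prod>v\<in>U. if \<forall>e\<in>J v. f e then 1/2 else (1::real))"
  have u: "u f = (1/2) ^ card (common_nbrs n {e \<in> I. f e} C)" for f
  proof -
    have "u f = (1/2) ^ card {v \<in> U. \<forall>e\<in>J v. f e}"
      by (simp add: u_def prod.If_cases U_def Int_def)
    also have "{v \<in> U. \<forall>e\<in>J v. f e} = common_nbrs n {e \<in> I. f e} C"
      using JI by (auto simp: common_nbrs_def U_def J_def)
    finally show ?thesis .
  qed
  have "measure_pmf.prob (random_graph n) {E. real (card (common_nbrs n E C)) < M}
      = measure_pmf.prob ?P {f. real (card (common_nbrs n {e \<in> I. f e} C)) < M}"
    by (simp add: random_graph_def I_def[symmetric] vimage_def)
  also have "\<dots> \<le> measure_pmf.prob ?P {f \<in> space ?P. u f \<ge> 2 powr (- M)}"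
  proof (rule measure_pmf.finite_measure_mono)
    show "{f. real (card (common_nbrs n {e \<in> I. f e} C)) < M} \<subseteq> {f \<in> space ?P. u f \<ge> 2 powr (- M)}"
    proof safe
      fix f assume "real (card (common_nbrs n {e \<in> I. f e} C)) < M"
      then have "2 powr (- M) \<le> 2 powr (- real (card (common_nbrs n {e \<in> I. f e} C)))"
        by simp
      also have "\<dots> = u f"
        unfolding u by (simp add: powr_minus powr_realpow power_one_over inverse_eq_divide)
      finally show "2 powr (- M) \<le> u f" .
    qed auto
  qed auto
  also have "\<dots> \<le> measure_pmf.expectation ?P u / 2 powr (- M)"
  proof (rule integral_Markov_inequality_measure[where A = "{}"])
    show "integrable (measure_pmf ?P) u"
      by (rule measure_pmf.integrable_const_bound[of _ 1]) (auto simp: u power_le_one)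
  qed (auto simp: u)
  also have "measure_pmf.expectation ?P u = (1 - (1/2) * (1/2) ^ card C) ^ (n - card C)"
    unfolding u_def
    by (subst expectation_Pi_pmf_bernoulli_blocks[OF _ finI JI dis])
      (auto simp: U_def[symmetric] cardJ cardU, auto simp: U_def)
  also have "\<dots> \<le> exp (- ((1/2) * (1/2) ^ card C)) ^ (n - card C)"
  proof (rule power_mono)
    show "1 - (1/2) * (1/2) ^ card C \<le> exp (- ((1/2) * (1/2) ^ card C :: real))"
      using exp_ge_add_one_self[of "- ((1/2) * (1/2) ^ card C :: real)"] by simp
    have "(1/2) ^ card C \<le> (1::real)" by (rule power_le_one) auto
    then show "(0::real) \<le> 1 - (1/2) * (1/2) ^ card C" by linarith
  qed
  also have "\<dots> = exp (- (real (n - card C) / (2 * 2 ^ card C)))"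
    by (simp add: exp_of_nat_mult[symmetric] power_one_over)
  finally show ?thesis
    by (simp add: powr_minus divide_right_mono field_simps)
qed

section \<open>First moment of weighted cliques in the planted graph\<close>

lemma prob_random_graph_superset:
  assumes "D \<subseteq> nsets {..<n} 2"
  shows "measure_pmf.prob (random_graph n) {E. D \<subseteq> E} = (1/2) ^ card D"
proof -
  have "measure_pmf.prob (random_graph n) {E. D \<subseteq> E}
    = measure_pmf.prob (Pi_pmf (nsets {..<n} 2) False (\<lambda>_. bernoulli_pmf (1/2))) {f. \<forall>e\<in>D. f e}"
    unfolding random_graph_def using assms
    by (auto simp: vimage_def intro!: arg_cong[where f = "measure_pmf.prob _"])
  then show ?thesis by (simp only: prob_Pi_pmf_bernoulli_all[OF finite_edges assms])
qed

lemma clique_iff_nsets: "clique C E \<longleftrightarrow> nsets C 2 \<subseteq> E"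
  by (auto simp: clique_def nsets_2_eq)

lemma real_choose_two: "real (n choose 2) = real n * (real n - 1) / 2"
proof -
  have "n choose 2 = n * (n - 1) div 2" by (rule choose_two)
  moreover have "even (n * (n - 1))" by (cases n) auto
  ultimately have "real (n choose 2) = real (n * (n - 1)) / 2"
    by (simp add: real_of_nat_div)
  then show ?thesis by (cases n) (auto simp: algebra_simps)
qed

text \<open>Pairs inside \<open>S\<close> are present for free. The exponent counts the remaining
  pairs of \<open>C\<close>, those with at least one vertex outside \<open>S\<close>.\<close>

lemma prob_clique_planted:
  assumes "C \<subseteq> {..<n}"
  shows "measure_pmf.prob (random_graph n) {E. clique C (E \<union> nsets S 2)}
    = 2 powr (- (real (card (C - S)) * (real (card (C - S)) - 1) / 2
        + real (card (C \<inter> S)) * real (card (C - S))))"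
proof -
  define r s where "r = card (C \<inter> S)" and "s = card (C - S)"
  define D where "D = nsets C 2 - nsets S 2"
  have finC: "finite C" using assms finite_subset by blast
  have D: "D \<subseteq> nsets {..<n} 2" using assms nsets_mono[of C "{..<n}" 2] by (auto simp: D_def)
  have cC: "card C = r + s" unfolding r_def s_def
    using card_Un_disjoint[of "C \<inter> S" "C - S"] finC by (metis Diff_disjoint Int_Diff_Un finite_Diff finite_Int inf_assoc inf_bot_right)
  have "D = nsets C 2 - nsets (C \<inter> S) 2"
    by (auto simp: D_def nsets_def)
  moreover have "nsets (C \<inter> S) 2 \<subseteq> nsets C 2" by (rule nsets_mono) auto
  moreover have "finite (nsets C 2)" using finC by (rule finite_imp_finite_nsets)
  ultimately have "card D = card (nsets C 2) - card (nsets (C \<inter> S) 2)"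
    and le: "card (nsets (C \<inter> S) 2) \<le> card (nsets C 2)"
    by (metis card_Diff_subset finite_subset, metis card_mono)
  then have "real (card D) = real ((r + s) choose 2) - real (r choose 2)"
    by (simp add: cC r_def of_nat_diff)
  also have "\<dots> = real s * (real s - 1) / 2 + real r * real s"
    by (simp add: real_choose_two field_simps)
  finally have cD: "real (card D) = real s * (real s - 1) / 2 + real r * real s" .
  have "{E. clique C (E \<union> nsets S 2)} = {E. D \<subseteq> E}"
    unfolding clique_iff_nsets D_def by blast
  then have "measure_pmf.prob (random_graph n) {E. clique C (E \<union> nsets S 2)} = (1/2) ^ card D"
    using prob_random_graph_superset[OF D] by simp
  also have "\<dots> = 2 powr (- real (card D))"
    by (simp add: powr_minus powr_realpow power_one_over inverse_eq_divide)
  finally show ?thesis unfolding cD r_def s_def .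
qed

text \<open>Markov's inequality. The weights later carry the cost of descending from a clique, so
  that boundary cliques of all sizes are treated by one sum.\<close>

lemma prob_clique_weight_ge:
  fixes w :: "nat set \<Rightarrow> real"
  assumes F: "\<F> \<subseteq> Pow {..<n}" and w: "\<And>C. w C \<ge> 0" and "l > 0"
  shows "measure_pmf.prob (random_graph n)
      {E. (\<Sum>C\<in>{C \<in> \<F>. clique C (E \<union> nsets S 2)}. w C) \<ge> l}
    \<le> (\<Sum>C\<in>\<F>. w C * 2 powr (- (real (card (C - S)) * (real (card (C - S)) - 1) / 2
        + real (card (C \<inter> S)) * real (card (C - S))))) / l"
proof -
  have finF: "finite \<F>" using F finite_subset by blast
  define W where "W = (\<lambda>E. \<Sum>C\<in>\<F>. w C * indicat_real {E. clique C (E \<union> nsets S 2)} E)"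
  have W: "W E = (\<Sum>C\<in>{C \<in> \<F>. clique C (E \<union> nsets S 2)}. w C)" for E
    using finF by (simp add: W_def indicator_def sum.inter_filter[symmetric] if_distrib Collect_conj_eq cong: if_cong)
  have int: "integrable (measure_pmf (random_graph n)) (indicat_real A)" for A
    by (rule measure_pmf.integrable_const_bound[of _ 1]) auto
  have "measure_pmf.prob (random_graph n) {E \<in> space (random_graph n). W E \<ge> l}
      \<le> measure_pmf.expectation (random_graph n) W / l"
    by (rule integral_Markov_inequality_measure[where A = "{}"])
      (use \<open>l > 0\<close> w in \<open>auto simp: W_def intro!: int Bochner_Integration.integrable_sum integrable_mult_right sum_nonneg\<close>)
  also have "measure_pmf.expectation (random_graph n) W
      = (\<Sum>C\<in>\<F>. w C * measure_pmf.prob (random_graph n) {E. clique C (E \<union> nsets S 2)})"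
    unfolding W_def by (subst Bochner_Integration.integral_sum) (auto intro!: int integrable_mult_right)
  also have "\<dots> = (\<Sum>C\<in>\<F>. w C * 2 powr (- (real (card (C - S)) * (real (card (C - S)) - 1) / 2
        + real (card (C \<inter> S)) * real (card (C - S)))))"
    by (intro sum.cong refl) (use F in \<open>auto simp: prob_clique_planted\<close>)
  finally show ?thesis by (simp add: W)
qed

text \<open>The edges and the planted set are sampled independently, so the set can be drawn first;
  a bound for every fixed \<open>S\<close> is then averaged.\<close>

lemma prob_planted_clique_ge:
  assumes "k \<le> n"
    and "\<And>S. S \<in> nsets {..<n} k \<Longrightarrow>
      measure_pmf.prob (random_graph n) {E. (E \<union> nsets S 2, S) \<in> A} \<ge> p"
  shows "measure_pmf.prob (planted_clique n k) A \<ge> p"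
proof -
  have fin: "finite (nsets {..<n} k)" by (simp add: finite_imp_finite_nsets)
  have ne: "nsets {..<n} k \<noteq> {}" using assms(1) by (simp add: nsets_eq_empty_iff)
  have eq: "planted_clique n k = bind_pmf (pmf_of_set (nsets {..<n} k))
      (\<lambda>S. map_pmf (\<lambda>E. (E \<union> nsets S 2, S)) (random_graph n))"
    unfolding planted_clique_def by (subst bind_commute_pmf) (simp add: map_pmf_def)
  have "p = (\<integral>S. p \<partial>measure_pmf (pmf_of_set (nsets {..<n} k)))" by simp
  also have "\<dots> \<le> measure_pmf.prob (planted_clique n k) A"
    unfolding eq prob_bind_pmf
  proof (rule integral_mono_AE)
    show "AE S in measure_pmf (pmf_of_set (nsets {..<n} k)).
        p \<le> measure_pmf.prob (map_pmf (\<lambda>E. (E \<union> nsets S 2, S)) (random_graph n)) A"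
    proof (rule AE_pmfI)
      fix S assume "S \<in> set_pmf (pmf_of_set (nsets {..<n} k))"
      then have "S \<in> nsets {..<n} k" using fin ne by simp
      then show "p \<le> measure_pmf.prob (map_pmf (\<lambda>E. (E \<union> nsets S 2, S)) (random_graph n)) A"
        using assms(2)[of S] by (simp add: vimage_def)
    qed
  qed (auto intro: integrable_prob_pmf simp del: measure_map_pmf)
  finally show ?thesis .
qed

lemma card_sets_with_intersection_le:
  assumes "S \<in> nsets {..<n} k"
  shows "card {C. C \<subseteq> {..<n} \<and> card (C \<inter> S) = r \<and> card (C - S) = s} \<le> k ^ r * n ^ s"
proof -
  let ?A = "{C. C \<subseteq> {..<n} \<and> card (C \<inter> S) = r \<and> card (C - S) = s}"
  have S: "finite S" "card S = k" using assms by (auto simp: nsets_def)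
  have inj: "inj_on (\<lambda>C. (C \<inter> S, C - S)) ?A"
    by (auto simp: inj_on_def)
  have sub: "(\<lambda>C. (C \<inter> S, C - S)) ` ?A \<subseteq> nsets S r \<times> nsets {..<n} s"
    using S by (auto simp: nsets_def intro: finite_subset[of _ "{..<n}"])
  have "card ?A \<le> card (nsets S r \<times> nsets {..<n} s)"
    using S by (intro card_inj_on_le[OF inj sub]) (simp add: finite_imp_finite_nsets)
  also have "\<dots> = (k choose r) * (n choose s)"
    using S by (simp add: card_cartesian_product)
  also have "\<dots> \<le> k ^ r * n ^ s"
    by (intro mult_le_mono) (metis binomial_le_pow binomial_eq_0 not_le zero_le)+
  finally show ?thesis .
qed

section \<open>Quantitative bounds\<close>

text \<open>With z = n / 2^q the Chernoff exponent is at most - z / 4, because 2 Q \<le> n, and the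
  tilt costs at most z / 8. The constant 8 thus leaves - z / 8, which is worst at size
  \<open>Q\<close>. There are at most Q n^Q sets to union over.\<close>

lemma prob_exists_few_common_nbrs:
  assumes "2 * Q \<le> n" "n \<ge> 1"
  shows "measure_pmf.prob (random_graph n)
      {E. \<exists>C\<subseteq>{..<n}. card C < Q \<and> real (card (common_nbrs n E C)) < real n / (8 * 2 ^ card C)}
    \<le> real Q * real n ^ Q * exp (- (real n / (8 * 2 ^ Q)))"
proof -
  define I where "I = (\<Union>q\<in>{..<Q}. nsets {..<n} q)"
  let ?P = "\<lambda>C. measure_pmf.prob (random_graph n)
      {E. real (card (common_nbrs n E C)) < real n / (8 * 2 ^ card C)}"
  have finI: "finite I" unfolding I_def by (simp add: finite_imp_finite_nsets)
  have "card I \<le> (\<Sum>q<Q. card (nsets {..<n} q))"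
    unfolding I_def by (intro card_UN_le) auto
  also have "\<dots> \<le> (\<Sum>q<Q. n ^ Q)"
  proof (rule sum_mono)
    fix q assume q: "q \<in> {..<Q}"
    have "card (nsets {..<n} q) \<le> n ^ q" using q assms by (simp add: binomial_le_pow)
    also have "\<dots> \<le> n ^ Q" using q assms by (intro power_increasing) auto
    finally show "card (nsets {..<n} q) \<le> n ^ Q" .
  qed
  finally have cardI: "card I \<le> Q * n ^ Q" by simp
  have each: "?P C \<le> exp (- (real n / (8 * 2 ^ Q)))" if "C \<in> I" for C
  proof -
    define q where "q = card C"
    have C: "C \<subseteq> {..<n}" "q < Q" using that by (auto simp: I_def nsets_def q_def)
    define z where "z = real n / 2 ^ q"
    have z: "z \<ge> 0" by (simp add: z_def)
    have "?P C \<le> 2 powr (real n / (8 * 2 ^ q)) * exp (- (real (n - q) / (2 * 2 ^ q)))"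
      unfolding q_def by (rule prob_common_nbrs_less[OF C(1)])
    also have "2 powr (real n / (8 * 2 ^ q)) = exp (z / 8 * ln 2)"
      by (simp add: powr_def z_def)
    also have "\<dots> \<le> exp (z / 8)"
      using z ln_le_minus_one[of 2] by (simp add: mult_left_le)
    also have "exp (- (real (n - q) / (2 * 2 ^ q))) \<le> exp (- (z / 4))"
    proof -
      have "2 * real (n - q) \<ge> real n" using C(2) assms(1) by linarith
      then have "real n / (4 * 2 ^ q) \<le> 2 * real (n - q) / (4 * 2 ^ q)"
        by (intro divide_right_mono) auto
      then show ?thesis by (simp add: z_def)
    qed
    also have "exp (z / 8) * exp (- (z / 4)) = exp (- (z / 8))"
      by (simp flip: exp_add)
    also have "\<dots> \<le> exp (- (real n / (8 * 2 ^ Q)))"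
    proof -
      have "(2::real) ^ q \<le> 2 ^ Q" using C(2) by (intro power_increasing) auto
      then have "real n / (8 * 2 ^ Q) \<le> real n / (8 * 2 ^ q)"
        by (intro divide_left_mono) auto
      then show ?thesis by (simp add: z_def)
    qed
    finally show ?thesis by simp
  qed
  have "{E. \<exists>C\<subseteq>{..<n}. card C < Q \<and> real (card (common_nbrs n E C)) < real n / (8 * 2 ^ card C)}
      = (\<Union>C\<in>I. {E. real (card (common_nbrs n E C)) < real n / (8 * 2 ^ card C)})"
    by (auto simp: I_def nsets_def intro: finite_subset[of _ "{..<n}"])
  then have "measure_pmf.prob (random_graph n)
      {E. \<exists>C\<subseteq>{..<n}. card C < Q \<and> real (card (common_nbrs n E C)) < real n / (8 * 2 ^ card C)}
    \<le> (\<Sum>C\<in>I. ?P C)"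
    using finI by (simp add: measure_pmf.finite_measure_subadditive_finite)
  also have "\<dots> \<le> real (card I) * exp (- (real n / (8 * 2 ^ Q)))"
    by (rule sum_bounded_above) (rule each)
  also have "\<dots> \<le> real (Q * n ^ Q) * exp (- (real n / (8 * 2 ^ Q)))"
    using cardI by (intro mult_right_mono) (simp_all only: of_nat_le_iff exp_ge_zero)
  finally show ?thesis by simp
qed

text \<open>Planting only adds edges, so common neighbours in the unplanted graph still extend every
  clique of the planted one.\<close>

lemma common_nbrs_subset_extensions:
  assumes "C \<in> cliques n (E \<union> E')"
  shows "common_nbrs n E C \<subseteq> {v \<in> {..<n} - C. insert v C \<in> cliques n (E \<union> E')}"
  using assms by (auto simp: common_nbrs_def cliques_def clique_def insert_commute)

text \<open>Grouping by the numbers r of planted and s of other vertices gives at most (x + 1)^2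
  classes, each with at most k^r n^s sets; classes that do not occur contribute nothing.\<close>

lemma sum_by_intersection_le:
  fixes g :: "nat \<Rightarrow> nat \<Rightarrow> real"
  assumes S: "S \<in> nsets {..<n} k" and F: "\<F> \<subseteq> Pow {..<n}" "\<And>C. C \<in> \<F> \<Longrightarrow> card C \<le> x"
    and g: "\<And>r s. g r s \<ge> 0" and "G \<ge> 0"
    and le: "\<And>C. C \<in> \<F> \<Longrightarrow>
      real k ^ card (C \<inter> S) * real n ^ card (C - S) * g (card (C \<inter> S)) (card (C - S)) \<le> G"
  shows "(\<Sum>C\<in>\<F>. g (card (C \<inter> S)) (card (C - S))) \<le> (real x + 1)\<^sup>2 * G"
proof -
  have finF: "finite \<F>" using F(1) finite_subset by blast
  let ?p = "\<lambda>C. (card (C \<inter> S), card (C - S))"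
  have "?p ` \<F> \<subseteq> {..x} \<times> {..x}"
  proof (rule image_subsetI)
    fix C assume C: "C \<in> \<F>"
    have "finite C" using C F(1) by (auto intro: finite_subset[of _ "{..<n}"])
    then have "card (C \<inter> S) \<le> card C" "card (C - S) \<le> card C" by (auto intro: card_mono)
    then show "?p C \<in> {..x} \<times> {..x}" using F(2)[OF C] by auto
  qed
  then have "(\<Sum>C\<in>\<F>. g (card (C \<inter> S)) (card (C - S)))
      = (\<Sum>rs\<in>{..x} \<times> {..x}. \<Sum>C\<in>{C \<in> \<F>. ?p C = rs}. g (card (C \<inter> S)) (card (C - S)))"
    by (intro sum.group[symmetric] finF) auto
  also have "\<dots> \<le> real (card ({..x} \<times> {..x})) * G"
  proof (rule sum_bounded_above)
    fix rs :: "nat \<times> nat"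
    obtain r s where rs: "rs = (r, s)" by (cases rs)
    show "(\<Sum>C\<in>{C \<in> \<F>. ?p C = rs}. g (card (C \<inter> S)) (card (C - S))) \<le> G"
    proof (cases "{C \<in> \<F>. ?p C = rs} = {}")
      case False
      then obtain C where C: "C \<in> \<F>" "card (C \<inter> S) = r" "card (C - S) = s" by (auto simp: rs)
      have "finite {C. C \<subseteq> {..<n} \<and> card (C \<inter> S) = r \<and> card (C - S) = s}"
        by (rule finite_subset[of _ "Pow {..<n}"]) auto
      then have "card {C \<in> \<F>. ?p C = rs} \<le> card {C. C \<subseteq> {..<n} \<and> card (C \<inter> S) = r \<and> card (C - S) = s}"
        using F(1) by (intro card_mono) (auto simp: rs)
      also have "\<dots> \<le> k ^ r * n ^ s" by (rule card_sets_with_intersection_le[OF S])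
      finally have "real (card {C \<in> \<F>. ?p C = rs}) \<le> real (k ^ r * n ^ s)"
        by (simp only: of_nat_le_iff)
      then have "real (card {C \<in> \<F>. ?p C = rs}) * g r s \<le> real (k ^ r * n ^ s) * g r s"
        by (intro mult_right_mono g)
      also have "\<dots> \<le> G" using le[OF C(1)] by (simp add: C)
      finally show ?thesis by (simp add: rs)
    next
      case True
      then show ?thesis using \<open>G \<ge> 0\<close> by (simp only: sum.empty)
    qed
  qed
  finally show ?thesis by (simp add: card_cartesian_product power2_eq_square algebra_simps)
qed

section \<open>The exponent of the first moment\<close>

text \<open>Base-2 exponent, with \<open>n = 2 powr L\<close>, of the weighted expected number of cliques having \<open>r\<close>
  vertices inside the planted clique and \<open>s\<close> outside it. Up to \<open>s / 2\<close> it equals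
  \<open>L\<^sup>2 / 2 - r * ((1 - \<alpha>) * L - r / 2) - (max 0 (r + s - L))\<^sup>2 / 2\<close>.\<close>

lemma clique_exponent_le:
  fixes L \<alpha> \<epsilon> \<gamma> \<kappa> r s x y :: real
  assumes L: "L \<ge> 10" and \<alpha>: "0 \<le> \<alpha>" "(1 - \<alpha>) * L \<ge> 1" and \<epsilon>: "0 < \<epsilon>" "\<epsilon> \<le> 1"
    and \<gamma>: "0 < \<gamma>" "\<gamma> \<le> 1 - \<alpha>" and \<kappa>: "\<kappa> \<le> \<epsilon>\<^sup>2 / 2" "\<kappa> \<le> \<gamma> * (1 - \<alpha>) / 2"
    and x: "(1 + \<epsilon>) * L \<le> x" "x \<le> (1 + \<epsilon>) * L + 1" and y: "\<gamma> * L \<le> y" "y \<le> \<gamma> * L + 1"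
    and rs: "0 \<le> r" "0 \<le> s" "r + s \<le> x" "r \<le> y" "r + s = x \<or> r = y"
  shows "\<alpha> * L * r + L * s + (max 0 (L - (r + s)))\<^sup>2 / 2 - (s * (s - 1) / 2 + r * s)
    \<le> L\<^sup>2 / 2 - \<kappa> * L\<^sup>2 + 3 * L"
proof -
  define u where "u = max 0 (r + s - L)"
  have "(max 0 (L - (r + s)))\<^sup>2 + u\<^sup>2 = (L - (r + s))\<^sup>2"
    unfolding u_def by (cases "L \<le> r + s") (auto simp: power2_eq_square algebra_simps max_def)
  then have "\<alpha> * L * r + L * s + (max 0 (L - (r + s)))\<^sup>2 / 2 - (s * (s - 1) / 2 + r * s)
      = L\<^sup>2 / 2 - r * ((1 - \<alpha>) * L - r / 2) - u\<^sup>2 / 2 + s / 2"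
    by (simp add: power2_eq_square field_simps)
  also have "\<dots> \<le> L\<^sup>2 / 2 - \<kappa> * L\<^sup>2 + 3 * L"
  proof -
    have "\<epsilon> * L \<le> 1 * L" using \<epsilon> L by (intro mult_right_mono) auto
    then have s: "s / 2 \<le> L + 1 / 2" using rs x(2) by (simp add: algebra_simps)
    have yL: "y \<le> (1 - \<alpha>) * L + 1"
      using y(2) L mult_right_mono[OF \<gamma>(2), of L] by linarith
    from rs(5) show ?thesis
    proof
      assume q: "r + s = x"
      \<comment> \<open>The size threshold is attained: the gain is half the square of the excess
        \<open>u\<close>, while the planted vertices cost at most 1/2.\<close>
      have "\<epsilon> * L \<le> u" using q x(1) by (simp add: u_def algebra_simps)
      then have "(\<epsilon> * L)\<^sup>2 \<le> u\<^sup>2" using \<epsilon> L by (intro power_mono) auto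
      then have u: "\<epsilon>\<^sup>2 * L\<^sup>2 \<le> u\<^sup>2" by (simp add: power_mult_distrib)
      have "\<kappa> * L\<^sup>2 \<le> \<epsilon>\<^sup>2 / 2 * L\<^sup>2" using \<kappa> by (intro mult_right_mono) auto
      moreover have "r * (r / 2 - 1) \<le> r * ((1 - \<alpha>) * L - r / 2)"
        using rs yL by (intro mult_left_mono) auto
      moreover have "r * (r / 2 - 1) \<ge> - 1 / 2"
        using zero_le_power2[of "r - 1"] by (simp add: power2_eq_square algebra_simps)
      ultimately show ?thesis using u s L by linarith
    next
      assume r: "r = y"
      \<comment> \<open>The intersection threshold is attained: since y \<le> (1 - \<alpha>) L + 1,
        subtracting r / 2 leaves at least ((1 - \<alpha>) L - 1) / 2 in the second factor. This
        yields the constant \<gamma> (1 - \<alpha>) / 2.\<close>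
      have "(\<gamma> * L) * (((1 - \<alpha>) * L - 1) / 2) \<le> r * ((1 - \<alpha>) * L - r / 2)"
        using r y yL \<alpha> \<gamma> L rs(1) by (intro mult_mono) (auto simp: field_simps)
      moreover have "(\<gamma> * L) * (((1 - \<alpha>) * L - 1) / 2) = \<gamma> * (1 - \<alpha>) / 2 * L\<^sup>2 - \<gamma> * L / 2"
        by (simp add: power2_eq_square field_simps)
      moreover have "\<kappa> * L\<^sup>2 \<le> \<gamma> * (1 - \<alpha>) / 2 * L\<^sup>2" using \<kappa> by (intro mult_right_mono) auto
      moreover have "\<gamma> * L \<le> 1 * L" using \<gamma> \<alpha> L by (intro mult_right_mono) auto
      moreover have "0 \<le> u\<^sup>2" by simp
      ultimately show ?thesis using s L by linarith
    qed
  qed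
  finally show ?thesis .
qed

section \<open>Size of the potential as a power of two\<close>

context
  fixes L b \<eta> :: real and n :: nat
  assumes n: "real n = 2 powr L" and L: "L > 0" and b: "b > 0" and small: "16 * L / b \<le> 2 powr (\<eta> * L)"
begin

text \<open>Each ratio of rates is a power of two of exponent about i - L, times a factor linear in
  L that \<open>small\<close> absorbs into 2 powr (\<eta> L). The exponents add up like differences
  of half squares of L - i.\<close>

lemma descent_le:
  assumes "real p \<le> L"
  shows "descent b (\<lambda>i. real n / (8 * 2 ^ i)) (Suc p)
    \<le> 2 powr (real p * (\<eta> * L) + (L - real p)\<^sup>2 / 2 - L\<^sup>2 / 2)"
  using assms
proof (induction p)
  case 0
  then show ?case by (simp add: descent_def)
next
  case (Suc p)
  let ?M = "\<lambda>i. real n / (8 * 2 ^ i)"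
  have "real (Suc p) / (b * ?M (Suc p)) = 8 * real (Suc p) / b * 2 powr (real (Suc p) - L)"
    using b by (simp add: n powr_diff powr_realpow field_simps del: of_nat_Suc power_Suc)
  also have "\<dots> \<le> 8 * L / b * 2 powr (real (Suc p) - L)"
    using Suc.prems b by (intro mult_right_mono divide_right_mono mult_left_mono) auto
  \<comment> \<open>Shifting the exponent from p + 1 to p doubles the 8.\<close>
  also have "\<dots> = 16 * L / b * 2 powr (real p - L)"
    by (simp add: powr_diff powr_add)
  also have "\<dots> \<le> 2 powr (\<eta> * L) * 2 powr (real p - L)"
    using small by (intro mult_right_mono) auto
  also have "\<dots> = 2 powr (\<eta> * L + real p - L)"
    by (simp add: powr_add[symmetric] add_diff_eq)
  \<comment> \<open>The difference of half squares equals p - L + 1/2, so 1/2 is to spare.\<close>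
  also have "\<dots> \<le> 2 powr (\<eta> * L + ((L - real (Suc p))\<^sup>2 - (L - real p)\<^sup>2) / 2)"
    by (intro powr_mono) (auto simp: power2_eq_square field_simps)
  finally have fac: "real (Suc p) / (b * ?M (Suc p))
      \<le> 2 powr (\<eta> * L + ((L - real (Suc p))\<^sup>2 - (L - real p)\<^sup>2) / 2)" .
  have "descent b ?M (Suc (Suc p)) = descent b ?M (Suc p) * (real (Suc p) / (b * ?M (Suc p)))"
    unfolding descent_def by (simp only: prod.atLeastLessThan_Suc One_nat_def Suc_le_eq zero_less_Suc)
  also have "\<dots> \<le> 2 powr (real p * (\<eta> * L) + (L - real p)\<^sup>2 / 2 - L\<^sup>2 / 2)
      * 2 powr (\<eta> * L + ((L - real (Suc p))\<^sup>2 - (L - real p)\<^sup>2) / 2)"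
    using Suc b by (intro mult_mono fac) auto
  also have "\<dots> = 2 powr (real (Suc p) * (\<eta> * L) + (L - real (Suc p))\<^sup>2 / 2 - L\<^sup>2 / 2)"
    by (subst powr_add[symmetric]) (rule arg_cong[where f = "(powr) 2"], simp add: field_simps)
  finally show ?case .
qed

text \<open>The loss 2 \<eta> L^2 has two sources: at most L factors 2 powr (\<eta> L) in the
  increments, and the cut-off at \<open>Q\<close> instead of L, which costs (\<eta> L + 2)^2 /
  2.\<close>

lemma potential_le:
  fixes T :: real
  assumes Q: "1 \<le> Q" "real Q \<le> L" "(1 - \<eta>) * L - 1 \<le> real Q"
    and \<eta>: "0 < \<eta>" "(\<eta> * L + 2)\<^sup>2 \<le> 2 * (\<eta> * L\<^sup>2)" and T: "T \<ge> 0"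
  shows "potential b (\<lambda>i. real n / (8 * 2 ^ i)) Q q + T * descent b (\<lambda>i. real n / (8 * 2 ^ i)) Q
    \<le> (real Q + T) * (2 powr (2 * \<eta> * L\<^sup>2 - L\<^sup>2 / 2) * 2 powr ((max 0 (L - real q))\<^sup>2 / 2))"
proof -
  let ?M = "\<lambda>i. real n / (8 * 2 ^ i)"
  let ?G = "2 powr (2 * \<eta> * L\<^sup>2 - L\<^sup>2 / 2) * 2 powr ((max 0 (L - real q))\<^sup>2 / 2)"
  \<comment> \<open>The alternative covers the increments in the potential (q < j) and the error
    increment (j = Q), which remains when q \<ge> Q.\<close>
  have D: "descent b ?M j \<le> ?G" if j: "1 \<le> j" "j \<le> Q" "q < j \<or> j = Q" for j
  proof -
    obtain p where p: "j = Suc p" using j by (cases j) auto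
    have pL: "real p \<le> L" using j Q p by simp
    have "real p * (\<eta> * L) \<le> L * (\<eta> * L)" using pL \<eta> L by (intro mult_right_mono) auto
    moreover have "(L - real p)\<^sup>2 / 2 \<le> (max 0 (L - real q))\<^sup>2 / 2 + \<eta> * L\<^sup>2"
      using j(3)
    proof
      assume "q < j"
      then have "(L - real p)\<^sup>2 \<le> (max 0 (L - real q))\<^sup>2"
        using pL p by (intro power_mono) auto
      moreover have "0 \<le> \<eta> * L\<^sup>2" using \<eta> by simp
      ultimately show ?thesis by linarith
    next
      assume "j = Q"
      then have "(L - real p)\<^sup>2 \<le> (\<eta> * L + 2)\<^sup>2"
        using pL p Q by (intro power_mono) (auto simp: algebra_simps)
      moreover have "0 \<le> (max 0 (L - real q))\<^sup>2" by simp
      ultimately show ?thesis using \<eta>(2) by linarith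
    qed
    moreover have "L * (\<eta> * L) = \<eta> * L\<^sup>2" by (simp add: power2_eq_square)
    ultimately have exponent: "real p * (\<eta> * L) + (L - real p)\<^sup>2 / 2 - L\<^sup>2 / 2
        \<le> (2 * \<eta> * L\<^sup>2 - L\<^sup>2 / 2) + (max 0 (L - real q))\<^sup>2 / 2"
      by linarith
    have "descent b ?M j \<le> 2 powr (real p * (\<eta> * L) + (L - real p)\<^sup>2 / 2 - L\<^sup>2 / 2)"
      unfolding p by (rule descent_le[OF pL])
    also have "\<dots> \<le> 2 powr ((2 * \<eta> * L\<^sup>2 - L\<^sup>2 / 2) + (max 0 (L - real q))\<^sup>2 / 2)"
      using exponent by (intro powr_mono) auto
    finally show ?thesis by (simp only: powr_add)
  qed
  have "potential b ?M Q q \<le> real (card {q<..Q}) * ?G"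
    unfolding potential_def using D by (intro sum_bounded_above) auto
  also have "\<dots> \<le> real Q * ?G" by (intro mult_right_mono) auto
  finally have "potential b ?M Q q \<le> real Q * ?G" .
  moreover have "T * descent b ?M Q \<le> T * ?G" using D Q T by (intro mult_left_mono) auto
  ultimately show ?thesis by (simp add: distrib_right)
qed

end

section \<open>The hitting bound at a fixed n\<close>

lemma st_event_iff:
  "{xs. \<exists>(C, i)\<in>set xs. a \<le> real (card C) \<or> b \<le> real (card (C \<inter> S))}
    = {xs. \<exists>(C, i)\<in>set xs. nat \<lceil>a\<rceil> \<le> card C \<or> nat \<lceil>b\<rceil> \<le> card (C \<inter> S)}"
  by (simp add: nat_ceiling_le_eq)

text \<open>Everything that holds only for large n is a hypothesis here, so the limit can be taken
  separately. The subtracted terms are the failure probabilities of the extension bound and of the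
  first moment bound.\<close>

lemma planted_st_bound:
  fixes L \<alpha> \<epsilon> \<gamma> K a \<kappa> \<eta> :: real and n m k c :: nat
  assumes n: "real n = 2 powr L" and L: "L \<ge> 10" "3 * L + 2 \<le> real n" "real m + 1 \<le> real n"
    and \<alpha>: "0 \<le> \<alpha>" "(1 - \<alpha>) * L \<ge> 1" and \<epsilon>: "0 < \<epsilon>" "\<epsilon> \<le> 1" and \<gamma>: "0 < \<gamma>" "\<gamma> \<le> 1 - \<alpha>"
    and K: "K > 0" and a: "0 \<le> a" "a \<le> 1"
    and \<kappa>: "\<kappa> \<le> \<epsilon>\<^sup>2 / 2" "\<kappa> \<le> \<gamma> * (1 - \<alpha>) / 2" "\<kappa> > 0" and \<eta>: "\<eta> = \<kappa> / 4"
    and Lbig: "\<eta> * L \<ge> 8" "2 * real c + 9 + 6 * K \<le> \<kappa> * L / 4" "16 * L / exp (- K) \<le> 2 powr (\<eta> * L)"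
    and k: "k \<le> n" "real k \<le> 2 powr (\<alpha> * L)"
  defines "Q \<equiv> nat \<lfloor>(1 - \<eta>) * L\<rfloor>"
  shows "1 - (real Q * real n ^ Q * exp (- (real n / (8 * 2 ^ Q))) + 1 / real n)
    \<le> measure_pmf.prob (planted_clique n k)
       {(E, PC). \<forall>(h :: nat \<Rightarrow> real) (\<beta> :: nat \<Rightarrow> real) (Z :: nat \<Rightarrow> real).
          mono_on {0..n} h \<longrightarrow> lipschitz1 n h \<longrightarrow> h 0 = 0 \<longrightarrow>
          strict_mono_on {0..m} \<beta> \<longrightarrow> (\<forall>i \<le> m. \<bar>\<beta> i\<bar> \<le> K) \<longrightarrow>
          strict_mono_on {0..m} Z \<longrightarrow> (\<forall>i \<le> m. Z i > 0) \<longrightarrow>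
          measure_pmf.prob (trajectory (st_kernel n E h m \<beta> Z a) (n ^ c) ({}, 0))
            {xs. \<exists>(C, i) \<in> set xs.
               real (card C) \<ge> (1 + \<epsilon>) * log 2 (real n) \<or>
               real (card (C \<inter> PC)) \<ge> \<gamma> * log 2 (real n)}
          \<le> 2 powr (- (\<kappa> / 4) * L\<^sup>2)}" (is "_ \<le> measure_pmf.prob _ ?A")
proof (rule prob_planted_clique_ge[OF k(1)])
  fix S assume S: "S \<in> nsets {..<n} k"
  define x where "x = nat \<lceil>(1 + \<epsilon>) * L\<rceil>"
  define y where "y = nat \<lceil>\<gamma> * L\<rceil>"
  define \<F> where "\<F> = {C. C \<subseteq> {..<n} \<and> card C \<le> x \<and> card (C \<inter> S) \<le> y \<and> (card C = x \<or> card (C \<inter> S) = y)}"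
  define w where "w = (\<lambda>C :: nat set. 2 powr ((max 0 (L - real (card C)))\<^sup>2 / 2))"
  define G where "G = 2 powr (L\<^sup>2 / 2 - \<kappa> * L\<^sup>2 + 3 * L)"
  \<comment> \<open>The extra factor n over the bound on the expected weight makes Markov's
    inequality fail with probability at most 1 / n.\<close>
  define l where "l = real n * ((real x + 1)\<^sup>2 * G)"
  define M where "M = (\<lambda>i::nat. real n / (8 * 2 ^ i))"
  define bad1 where "bad1 = {E. \<exists>C\<subseteq>{..<n}. card C < Q \<and>
    real (card (common_nbrs n E C)) < real n / (8 * 2 ^ card C)}"
  define bad2 where "bad2 = {E. (\<Sum>C\<in>{C \<in> \<F>. clique C (E \<union> nsets S 2)}. w C) \<ge> l}"
  have logn: "log 2 (real n) = L" by (simp add: n)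
  have n0: "n > 0" using n by (metis of_nat_0_less_iff powr_gt_zero zero_neq_numeral)
  have \<alpha>1: "\<alpha> < 1" using \<gamma> by linarith
  have "\<epsilon>\<^sup>2 \<le> 1" using \<epsilon> by (simp add: power_le_one)
  then have \<kappa>1: "\<kappa> \<le> 1 / 2" using \<kappa> by linarith
  have \<eta>1: "0 < \<eta>" "\<eta> \<le> 1 / 8" using \<kappa> \<kappa>1 \<eta> by auto
  have x: "(1 + \<epsilon>) * L \<le> real x" "real x \<le> (1 + \<epsilon>) * L + 1"
    and y: "\<gamma> * L \<le> real y" "real y \<le> \<gamma> * L + 1"
    unfolding x_def y_def using \<epsilon> \<gamma> L(1) by (auto simp: of_nat_nat of_int_ceiling_le_add_one intro: le_of_int_ceiling)
  have "\<epsilon> * L \<le> 1 * L" using \<epsilon> L(1) by (intro mult_right_mono) auto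
  then have x2: "real x \<le> 2 * L + 1" using x(2) by (simp add: algebra_simps)
  have xn: "x + 1 \<le> n" "x \<le> n" using x2 L by linarith+
  have "0 < (1 + \<epsilon>) * L" "0 < \<gamma> * L" using \<epsilon> \<gamma> L(1) by auto
  then have xy1: "1 \<le> x" "1 \<le> y" using x y by linarith+
  have "1 * 10 / 2 \<le> (1 - \<eta>) * L" using \<eta>1 L(1) mult_mono[of "1/2" "1 - \<eta>" 10 L] by simp
  then have Q: "(1 - \<eta>) * L - 1 \<le> real Q" "real Q \<le> (1 - \<eta>) * L" "1 \<le> Q"
    unfolding Q_def by linarith+
  have "0 \<le> \<eta> * L" using Lbig(1) by linarith
  then have QL: "real Q \<le> L" using Q(2) by (simp add: algebra_simps)
  have Qn: "2 * Q \<le> n" "Q \<le> n" using QL L by linarith+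
  have Qx: "Q \<le> x"
  proof -
    have "L \<le> (1 + \<epsilon>) * L" using \<epsilon> L(1) by (simp add: algebra_simps)
    then show ?thesis using QL x(1) by linarith
  qed
  have \<eta>2: "(\<eta> * L + 2)\<^sup>2 \<le> 2 * (\<eta> * L\<^sup>2)"
  proof -
    have "\<eta> * L \<le> 1 / 8 * L" using \<eta>1 L(1) by (intro mult_right_mono) auto
    then have "(\<eta> * L) * (\<eta> * L) \<le> (\<eta> * L) * (1 / 8 * L)" using Lbig(1) by (intro mult_left_mono) auto
    moreover have "8 * 10 \<le> (\<eta> * L) * L" using Lbig(1) L(1) by (intro mult_mono) auto
    moreover have "(\<eta> * L) * 10 \<le> (\<eta> * L) * L" using Lbig(1) L(1) by (intro mult_left_mono) auto
    ultimately show ?thesis by (simp add: power2_eq_square algebra_simps)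
  qed
  have G0: "G > 0" by (simp add: G_def)
  have l0: "l > 0" unfolding l_def using n0 G0 by (intro mult_pos_pos zero_less_power) auto

  have "measure_pmf.prob (random_graph n) bad1 \<le> real Q * real n ^ Q * exp (- (real n / (8 * 2 ^ Q)))"
    unfolding bad1_def by (rule prob_exists_few_common_nbrs) (use Qn n0 in auto)
  moreover have "measure_pmf.prob (random_graph n) bad2 \<le> 1 / real n"
  proof -
    let ?g = "\<lambda>r s. 2 powr ((max 0 (L - (real r + real s)))\<^sup>2 / 2)
      * 2 powr (- (real s * (real s - 1) / 2 + real r * real s))"
    have cC: "real (card C) = real (card (C \<inter> S)) + real (card (C - S))" if "C \<in> \<F>" for C
    proof -
      have "finite C" using that by (auto simp: \<F>_def intro: finite_subset[of _ "{..<n}"])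
      then have "card (C \<inter> S \<union> (C - S)) = card (C \<inter> S) + card (C - S)"
        by (intro card_Un_disjoint) auto
      then show ?thesis by (simp add: Int_Diff_Un)
    qed
    have "measure_pmf.prob (random_graph n) bad2
      \<le> (\<Sum>C\<in>\<F>. w C * 2 powr (- (real (card (C - S)) * (real (card (C - S)) - 1) / 2
        + real (card (C \<inter> S)) * real (card (C - S))))) / l"
      unfolding bad2_def by (rule prob_clique_weight_ge) (use l0 in \<open>auto simp: \<F>_def w_def\<close>)
    also have "(\<Sum>C\<in>\<F>. w C * 2 powr (- (real (card (C - S)) * (real (card (C - S)) - 1) / 2
        + real (card (C \<inter> S)) * real (card (C - S)))))
      = (\<Sum>C\<in>\<F>. ?g (card (C \<inter> S)) (card (C - S)))"
      by (intro sum.cong refl) (simp add: w_def cC)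
    also have "\<dots> \<le> (real x + 1)\<^sup>2 * G"
    proof (rule sum_by_intersection_le[OF S])
      fix C assume C: "C \<in> \<F>"
      define r s where "r = card (C \<inter> S)" and "s = card (C - S)"
      have rs: "0 \<le> real r" "0 \<le> real s" "real r + real s \<le> real x" "real r \<le> real y"
        "real r + real s = real x \<or> real r = real y"
        using C cC[OF C] by (auto simp: \<F>_def r_def s_def)
      have "real k ^ r * real n ^ s * ?g r s \<le> (2 powr (\<alpha> * L)) ^ r * (2 powr L) ^ s * ?g r s"
        unfolding n using k(2) by (intro mult_right_mono power_mono) auto
      also have "\<dots> = 2 powr (\<alpha> * L * real r + L * real s + (max 0 (L - (real r + real s)))\<^sup>2 / 2
          - (real s * (real s - 1) / 2 + real r * real s))"
        by (simp only: powr_realpow[symmetric] powr_gt_zero powr_powr powr_add[symmetric])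
          (simp add: powr_powr powr_add[symmetric] powr_realpow[symmetric] algebra_simps)
      also have "\<dots> \<le> G"
        unfolding G_def
        by (intro powr_mono clique_exponent_le[OF L(1) \<alpha> \<epsilon> \<gamma> \<kappa>(1,2) x y rs]) auto
      finally show "real k ^ r * real n ^ s * ?g r s \<le> G" .
    qed (use G0 in \<open>auto simp: \<F>_def\<close>)
    also have "(real x + 1)\<^sup>2 * G / l = 1 / real n"
    proof -
      have "(real x + 1)\<^sup>2 * G > 0" using G0 by (intro mult_pos_pos zero_less_power) auto
      then show ?thesis using n0 G0 by (simp add: l_def)
    qed
    finally show ?thesis using l0 by (simp add: divide_right_mono)
  qed
  moreover have "measure_pmf.prob (random_graph n) (bad1 \<union> bad2)
      \<le> measure_pmf.prob (random_graph n) bad1 + measure_pmf.prob (random_graph n) bad2"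
    by (rule measure_Un_le) auto
  moreover have "measure_pmf.prob (random_graph n) (- (bad1 \<union> bad2))
      = 1 - measure_pmf.prob (random_graph n) (bad1 \<union> bad2)"
    using measure_pmf.prob_compl[of "bad1 \<union> bad2" "random_graph n"] by (simp add: Compl_eq_Diff_UNIV)
  ultimately have "1 - (real Q * real n ^ Q * exp (- (real n / (8 * 2 ^ Q))) + 1 / real n)
      \<le> measure_pmf.prob (random_graph n) (- (bad1 \<union> bad2))" by linarith
  also have "\<dots> \<le> measure_pmf.prob (random_graph n) {E. (E \<union> nsets S 2, S) \<in> ?A}"
  proof (rule measure_pmf.finite_measure_mono)
    show "- (bad1 \<union> bad2) \<subseteq> {E. (E \<union> nsets S 2, S) \<in> ?A}"
    \<comment> \<open>The graph is fixed before \<open>h\<close>, \<beta> and \<open>Z\<close>; from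
      here on the argument is deterministic in the graph.\<close>
    proof (rule subsetI, unfold mem_Collect_eq prod.case, intro allI impI)
      fix E0 and h \<beta> Z :: "nat \<Rightarrow> real"
      assume good: "E0 \<in> - (bad1 \<union> bad2)" and lip: "lipschitz1 n h" and h0: "h 0 = 0"
        and \<beta>: "\<forall>i\<le>m. \<bar>\<beta> i\<bar> \<le> K" and Zmono: "strict_mono_on {0..m} Z" and Zpos: "\<forall>i\<le>m. Z i > 0"
      define E where "E = E0 \<union> nsets S 2"
      define T where "T = real (n ^ c)"
      have lipq: "\<bar>h q - h q'\<bar> \<le> \<bar>real q - real q'\<bar>" if "q \<le> x" "q' \<le> x" for q q'
      proof -
        \<comment> \<open>The Lipschitz condition reaches up to 2.1 L, and x \<le> 2 L + 1 \<le> 2.1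
          L holds because L \<ge> 10.\<close>
        have "real q \<le> 2.1 * L" "real q' \<le> 2.1 * L" using that x2 L(1) by linarith+
        moreover have "q \<le> n" "q' \<le> n" using that xn by linarith+
        ultimately show ?thesis using lip unfolding lipschitz1_def logn by blast
      qed
      have up: "exp (- K) \<le> exp (\<beta> i * (h (Suc q) - h q))" if "i \<le> m" "q < Q" for i q
      proof -
        have "\<bar>h (Suc q) - h q\<bar> \<le> 1" using lipq[of "Suc q" q] that Qx by simp
        then have "\<bar>\<beta> i * (h (Suc q) - h q)\<bar> \<le> K * 1"
          unfolding abs_mult using \<beta> that(1) K by (intro mult_mono) auto
        then show ?thesis by simp
      qed
      have R: "exp (\<beta> i * h q) * Z 0 / Z i \<le> exp (K * real x)" if "i \<le> m" "q \<le> x" for i q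
      proof -
        have "\<bar>h q\<bar> \<le> real x" using lipq[of q 0] that h0 by simp
        then have "\<bar>\<beta> i * h q\<bar> \<le> K * real x"
          unfolding abs_mult using \<beta> that(1) K by (intro mult_mono) auto
        then have "exp (\<beta> i * h q) \<le> exp (K * real x)" by simp
        moreover have "Z 0 / Z i \<le> 1"
        proof (cases "i = 0")
          case False
          then have "Z 0 < Z i" using Zmono that(1) by (intro strict_mono_onD[of "{0..m}" Z]) auto
          then show ?thesis using Zpos that(1) by (simp add: divide_le_eq)
        qed simp
        moreover have "0 \<le> Z 0 / Z i" using Zpos that(1) by (simp add: less_imp_le)
        ultimately have "exp (\<beta> i * h q) * (Z 0 / Z i) \<le> exp (K * real x) * 1"
          by (intro mult_mono) auto
        then show ?thesis by simp
      qed
      have ext: "M (card C) \<le> real (card {v \<in> {..<n} - C. insert v C \<in> cliques n E})"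
        if "C \<in> cliques n E" "card C < Q" for C
      proof -
        have "M (card C) \<le> real (card (common_nbrs n E0 C))"
          using good that by (auto simp: bad1_def M_def cliques_def not_less)
        also have "\<dots> \<le> real (card {v \<in> {..<n} - C. insert v C \<in> cliques n E})"
          using common_nbrs_subset_extensions[of C n E0 "nsets S 2"] that(1)
          by (intro of_nat_mono card_mono) (auto simp: E_def)
        finally show ?thesis .
      qed
      have Fcl: "{C \<in> cliques n E. card C \<le> x \<and> card (C \<inter> S) \<le> y \<and> (card C = x \<or> card (C \<inter> S) = y)}
          = {C \<in> \<F>. clique C E}" (is "?F = _")
        by (auto simp: cliques_def \<F>_def)
      have W: "(\<Sum>C\<in>?F. w C) \<le> l"
        using good unfolding Fcl by (auto simp: bad2_def E_def)
      have "measure_pmf.prob (trajectory (st_kernel n E h m \<beta> Z a) (n ^ c) ({}, 0))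
            {xs. \<exists>(C, i) \<in> set xs. x \<le> card C \<or> y \<le> card (C \<inter> S)}
        \<le> (T + 1) * (real m + 1) * exp (K * real x) *
          (\<Sum>C\<in>?F. potential (exp (- K)) M Q (card C) + T * descent (exp (- K)) M Q)"
        unfolding T_def
        by (rule prob_st_hit_le[where b = "exp (- K)" and M = M and h = h and \<beta> = \<beta> and Z = Z
            and R = "exp (K * real x)", OF _ _ a _ n0 _ Q(3) Qn(2) h0 ext up xy1 R])
          (use Zpos K n0 in \<open>auto simp: M_def\<close>)
      also have "\<dots> \<le> (T + 1) * (real m + 1) * exp (K * real x) *
          (\<Sum>C\<in>?F. (real Q + T) * (2 powr (2 * \<eta> * L\<^sup>2 - L\<^sup>2 / 2) * w C))"
        unfolding M_def w_def using L(1) Q QL \<eta>1 \<eta>2 Lbig n0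
        by (intro mult_left_mono sum_mono potential_le[OF n]) (auto simp: T_def)
      also have "\<dots> = (T + 1) * (real m + 1) * exp (K * real x) *
          ((real Q + T) * (2 powr (2 * \<eta> * L\<^sup>2 - L\<^sup>2 / 2) * (\<Sum>C\<in>?F. w C)))"
        by (simp add: sum_distrib_left)
      also have "\<dots> \<le> 2 powr ((real c + 1) * L) * 2 powr L * 2 powr (6 * K * L) *
          (2 powr ((real c + 1) * L) * (2 powr (2 * \<eta> * L\<^sup>2 - L\<^sup>2 / 2) *
            (2 powr L * ((2 powr L)\<^sup>2 * 2 powr (L\<^sup>2 / 2 - \<kappa> * L\<^sup>2 + 3 * L)))))"
      proof -
        have "1 \<le> real n ^ c" using n0 by (simp add: one_le_power)
        moreover have nc: "real n ^ Suc c = 2 powr ((real c + 1) * L)"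
          by (simp only: n powr_realpow[symmetric] powr_gt_zero powr_powr) (simp add: algebra_simps)
        moreover have "real n * 1 \<le> real n * real n ^ c" "2 * real n ^ c \<le> real n * real n ^ c"
            "4 * real n ^ c \<le> real n * real n ^ c"
          using L n0 by (intro mult_left_mono mult_right_mono one_le_power; simp)+
        moreover have "2 * real Q \<le> real n" using Qn(1) by linarith
        ultimately have TQ: "T + 1 \<le> 2 powr ((real c + 1) * L)" "real Q + T \<le> 2 powr ((real c + 1) * L)"
          unfolding T_def by simp_all
        have "exp (K * real x) \<le> exp (K * (3 * L))"
          using x2 L(1) K by simp
        also have "\<dots> \<le> exp (6 * K * L * ln 2)"
        proof -
          have "(6 * K * L) * (1 / 2) \<le> (6 * K * L) * ln 2"
            using K L(1) ln2_ge_two_thirds by (intro mult_left_mono) auto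
          then show ?thesis by simp
        qed
        also have "\<dots> = 2 powr (6 * K * L)" by (simp add: powr_def)
        finally have ex: "exp (K * real x) \<le> 2 powr (6 * K * L)" .
        have "(real x + 1)\<^sup>2 \<le> (2 powr L)\<^sup>2"
          using xn unfolding n[symmetric] by (intro power_mono) auto
        then have "l \<le> 2 powr L * ((2 powr L)\<^sup>2 * 2 powr (L\<^sup>2 / 2 - \<kappa> * L\<^sup>2 + 3 * L))"
          unfolding l_def G_def n by (intro mult_left_mono mult_right_mono) auto
        with W have W': "(\<Sum>C\<in>?F. w C) \<le> 2 powr L * ((2 powr L)\<^sup>2 * 2 powr (L\<^sup>2 / 2 - \<kappa> * L\<^sup>2 + 3 * L))"
          by linarith
        have m: "real m + 1 \<le> 2 powr L" using L(3) n by simp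
        have T0: "T \<ge> 0" by (simp add: T_def)
        show ?thesis
          by (intro mult_mono TQ ex m W' order_refl mult_nonneg_nonneg sum_nonneg)
            (use T0 in \<open>auto simp: w_def\<close>)
      qed
      \<comment> \<open>The linear terms are c + 1 each from the factors \<open>T + 1\<close> and
        \<open>Q + T\<close>, 1 from the temperatures, 6 K from \<open>R\<close>, and 1 + 2 + 3 from
        \<open>l\<close>. The terms L^2 / 2 from clique count and descent cancel.\<close>
      also have "\<dots> = 2 powr ((2 * real c + 9 + 6 * K) * L + 2 * \<eta> * L\<^sup>2 - \<kappa> * L\<^sup>2)"
        by (simp only: power2_eq_square[of "2 powr L"] powr_add[symmetric]) (simp add: algebra_simps)
      also have "\<dots> \<le> 2 powr (- (\<kappa> / 4) * L\<^sup>2)"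
      proof (intro powr_mono)
        \<comment> \<open>Of the gain \<kappa> L^2, one half pays for 2 \<eta> L^2, one quarter for
          the linear terms, and one quarter remains.\<close>
        have "(2 * real c + 9 + 6 * K) * L \<le> (\<kappa> * L / 4) * L"
          using Lbig(2) L(1) by (intro mult_right_mono) auto
        moreover have "(\<kappa> * L / 4) * L = \<kappa> * L\<^sup>2 / 4" "2 * \<eta> * L\<^sup>2 = \<kappa> * L\<^sup>2 / 2"
          by (simp_all add: \<eta> power2_eq_square)
        ultimately show "(2 * real c + 9 + 6 * K) * L + 2 * \<eta> * L\<^sup>2 - \<kappa> * L\<^sup>2 \<le> - (\<kappa> / 4) * L\<^sup>2"
          by linarith
      qed auto
      finally show "measure_pmf.prob (trajectory (st_kernel n (E0 \<union> nsets S 2) h m \<beta> Z a) (n ^ c) ({}, 0))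
          {xs. \<exists>(C, i)\<in>set xs. (1 + \<epsilon>) * log 2 (real n) \<le> real (card C) \<or>
            \<gamma> * log 2 (real n) \<le> real (card (C \<inter> S))}
        \<le> 2 powr (- (\<kappa> / 4) * L\<^sup>2)"
        unfolding st_event_iff logn x_def y_def E_def .
    qed
  qed auto
  finally show "1 - (real Q * real n ^ Q * exp (- (real n / (8 * 2 ^ Q))) + 1 / real n)
    \<le> measure_pmf.prob (random_graph n) {E. (E \<union> nsets S 2, S) \<in> ?A}" .
qed

section \<open>Letting n tend to infinity\<close>

theorem theorem8p5:
  fixes \<alpha> \<epsilon> \<gamma> K a :: real and c :: nat and m :: "nat \<Rightarrow> nat"
  assumes "0 \<le> \<alpha>" and "\<alpha> < 1"
    and "0 < \<epsilon>" and "\<epsilon> < 1 - \<alpha>"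
    and "0 < \<gamma>" and "\<gamma> \<le> 1 - \<alpha>"
    and "K > 0"
    and "0 < a" and "a < 1"
    and "\<And>n. m n \<ge> 1"
    and "(\<lambda>n. real (m n)) \<in> o(\<lambda>n. log 2 (real n))"
  shows "\<exists>\<delta> :: nat \<Rightarrow> real. superpoly_small \<delta> \<and>
    (\<lambda>n. measure_pmf.prob (planted_clique n (nat \<lfloor>real n powr \<alpha>\<rfloor>))
       {(E, PC). \<forall>(h :: nat \<Rightarrow> real) (\<beta> :: nat \<Rightarrow> real) (Z :: nat \<Rightarrow> real).
          mono_on {0..n} h \<longrightarrow> lipschitz1 n h \<longrightarrow> h 0 = 0 \<longrightarrow>
          strict_mono_on {0..m n} \<beta> \<longrightarrow> (\<forall>i \<le> m n. \<bar>\<beta> i\<bar> \<le> K) \<longrightarrow>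
          strict_mono_on {0..m n} Z \<longrightarrow> (\<forall>i \<le> m n. Z i > 0) \<longrightarrow>
          measure_pmf.prob (trajectory (st_kernel n E h (m n) \<beta> Z a) (n ^ c) ({}, 0))
            {xs. \<exists>(C, i) \<in> set xs.
               real (card C) \<ge> (1 + \<epsilon>) * log 2 (real n) \<or>
               real (card (C \<inter> PC)) \<ge> \<gamma> * log 2 (real n)}
          \<le> \<delta> n})
    \<longlonglongrightarrow> 1"
proof -
  \<comment> \<open>The smaller of the gains at the two thresholds; \<eta> is chosen so that the
    loss 2 \<eta> L^2 uses half of it.\<close>
  define \<kappa> where "\<kappa> = min (\<epsilon>\<^sup>2 / 2) (\<gamma> * (1 - \<alpha>) / 2)"
  define \<eta> where "\<eta> = \<kappa> / 4"
  define L where "L = (\<lambda>n::nat. log 2 (real n))"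
  define \<delta> where "\<delta> = (\<lambda>n. 2 powr (- (\<kappa> / 4) * (L n)\<^sup>2))"
  define Q where "Q = (\<lambda>n. nat \<lfloor>(1 - \<eta>) * L n\<rfloor>)"
  \<comment> \<open>As 2^Q \<le> n^(1 - \<eta>), the Chernoff exponent n / (8 * 2^Q) is at least
    n^\<eta> / 8. This beats the union bound, whose size n^(L + 1) is quasi-polynomial.\<close>
  define err where "err = (\<lambda>n. real n powr (L n + 1) * exp (- (real n powr \<eta> / 8)) + 1 / real n)"
  let ?P = "\<lambda>n. measure_pmf.prob (planted_clique n (nat \<lfloor>real n powr \<alpha>\<rfloor>))
       {(E, PC). \<forall>(h :: nat \<Rightarrow> real) (\<beta> :: nat \<Rightarrow> real) (Z :: nat \<Rightarrow> real).
          mono_on {0..n} h \<longrightarrow> lipschitz1 n h \<longrightarrow> h 0 = 0 \<longrightarrow>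
          strict_mono_on {0..m n} \<beta> \<longrightarrow> (\<forall>i \<le> m n. \<bar>\<beta> i\<bar> \<le> K) \<longrightarrow>
          strict_mono_on {0..m n} Z \<longrightarrow> (\<forall>i \<le> m n. Z i > 0) \<longrightarrow>
          measure_pmf.prob (trajectory (st_kernel n E h (m n) \<beta> Z a) (n ^ c) ({}, 0))
            {xs. \<exists>(C, i) \<in> set xs.
               real (card C) \<ge> (1 + \<epsilon>) * log 2 (real n) \<or>
               real (card (C \<inter> PC)) \<ge> \<gamma> * log 2 (real n)}
          \<le> \<delta> n}"
  have \<kappa>: "\<kappa> \<le> \<epsilon>\<^sup>2 / 2" "\<kappa> \<le> \<gamma> * (1 - \<alpha>) / 2" "\<kappa> > 0"
    using assms by (auto simp: \<kappa>_def)
  have "\<epsilon>\<^sup>2 \<le> 1" using assms by (simp add: power_le_one)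
  then have \<eta>: "\<eta> > 0" and \<eta>1: "\<eta> \<le> 1" using \<kappa> by (auto simp: \<eta>_def)
  have powL: "real n = 2 powr L n" if "n > 0" for n
    using that by (simp add: L_def)
  have L_top: "filterlim L at_top sequentially"
    unfolding L_def by real_asymp
  have L_ge: "eventually (\<lambda>n. L n \<ge> B) sequentially" for B
    using L_top by (simp add: filterlim_at_top)
  have "superpoly_small \<delta>"
    unfolding superpoly_small_def
  proof (intro allI impI)
    fix D :: real assume "D > 0"
    show "eventually (\<lambda>n. \<delta> n \<le> real n powr (- D)) sequentially"
      using L_ge[of "4 * D / \<kappa>"] L_ge[of 0] eventually_gt_at_top[of 0]
    proof eventually_elim
      case (elim n)
      \<comment> \<open>\<open>\<delta> n\<close> is n to the power - (\<kappa> / 4) L, so it falls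
        below n^(-D) once L exceeds 4 D / \<kappa>.\<close>
      have "4 * D / \<kappa> * L n \<le> L n * L n" using elim by (intro mult_right_mono) auto
      then have "D * L n \<le> \<kappa> / 4 * (L n)\<^sup>2"
        using \<kappa>(3) by (simp add: field_simps power2_eq_square)
      then show ?case
        unfolding \<delta>_def by (subst powL[OF elim(3)]) (simp add: powr_powr mult.commute)
    qed
  qed
  moreover have "?P \<longlonglongrightarrow> 1"
  proof (rule tendsto_sandwich)
    have "eventually (\<lambda>n. 3 * L n + 2 \<le> real n) sequentially"
      unfolding L_def by real_asymp
    moreover have "eventually (\<lambda>n. 16 * L n / exp (- K) \<le> real n powr \<eta>) sequentially"
      unfolding L_def using \<eta> by real_asymp
    moreover have "eventually (\<lambda>n. norm (real (m n)) \<le> 1 * norm (log 2 (real n))) sequentially"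
      using assms(11) by (rule landau_o.smallD) simp
    ultimately show "eventually (\<lambda>n. 1 - err n \<le> ?P n) sequentially"
      using L_ge[of 10] L_ge[of "1 / (1 - \<alpha>)"] L_ge[of "8 / \<eta>"]
        L_ge[of "4 * (2 * real c + 9 + 6 * K) / \<kappa>"] eventually_gt_at_top[of 0]
    proof eventually_elim
      case (elim n)
      have n1: "1 \<le> real n" using elim(8) by simp
      have mn: "real (m n) + 1 \<le> real n" using elim(1,3,4) by (simp add: L_def)
      have powr_le: "real n powr \<alpha> \<le> real n powr 1" using n1 assms by (intro powr_mono) auto
      have k: "nat \<lfloor>real n powr \<alpha>\<rfloor> \<le> n" "real (nat \<lfloor>real n powr \<alpha>\<rfloor>) \<le> 2 powr (\<alpha> * L n)"
      proof -
        have "real (nat \<lfloor>real n powr \<alpha>\<rfloor>) \<le> real n powr \<alpha>" by (simp add: of_nat_nat)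
        then show "real (nat \<lfloor>real n powr \<alpha>\<rfloor>) \<le> 2 powr (\<alpha> * L n)"
          by (simp add: powL[OF elim(8)] powr_powr mult.commute)
        show "nat \<lfloor>real n powr \<alpha>\<rfloor> \<le> n"
          using powr_le n1 by (simp add: nat_le_iff floor_le_iff)
      qed
      have base: "16 * L n / exp (- K) \<le> 2 powr (\<eta> * L n)"
        using elim(2) by (simp add: powL[OF elim(8)] powr_powr mult.commute)
      have "1 - (real (Q n) * real n ^ Q n * exp (- (real n / (8 * 2 ^ Q n))) + 1 / real n) \<le> ?P n"
        unfolding \<delta>_def Q_def
        by (rule planted_st_bound[OF powL[OF elim(8)] elim(4,1) mn assms(1) _ assms(3) _ assms(5,6,7) _ _ \<kappa> \<eta>_def _ _ base k])
          (use elim assms \<kappa> \<eta> in \<open>auto simp: field_simps\<close>)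
      moreover have "real (Q n) * real n ^ Q n * exp (- (real n / (8 * 2 ^ Q n)))
          \<le> real n powr (L n + 1) * exp (- (real n powr \<eta> / 8))"
      proof -
        have "0 \<le> (1 - \<eta>) * L n" "0 \<le> \<eta> * L n" using elim(4) \<eta> \<eta>1 by auto
        then have Q: "real (Q n) \<le> (1 - \<eta>) * L n" "real (Q n) \<le> L n"
          unfolding Q_def left_diff_distrib by (simp, linarith)
        have "real n ^ Q n = real n powr real (Q n)" using elim(8) by (simp add: powr_realpow)
        also have "\<dots> \<le> real n powr L n" using Q n1 by (intro powr_mono) auto
        finally have "real (Q n) * real n ^ Q n \<le> real n powr L n * real n"
          using Q elim(1,4) by (subst mult.commute) (intro mult_mono, auto)
        then have 1: "real (Q n) * real n ^ Q n \<le> real n powr (L n + 1)"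
          using n1 by (simp add: powr_add)
        have "(2::real) ^ Q n = 2 powr real (Q n)" by (simp add: powr_realpow)
        also have "\<dots> \<le> 2 powr ((1 - \<eta>) * L n)" using Q by (intro powr_mono) auto
        finally have "real n powr \<eta> * 2 ^ Q n \<le> 2 powr (\<eta> * L n) * 2 powr ((1 - \<eta>) * L n)"
          by (intro mult_mono) (simp_all add: powL[OF elim(8)] powr_powr mult.commute)
        also have "\<dots> = real n"
          by (simp add: powL[OF elim(8)] powr_add[symmetric] algebra_simps)
        finally have "real n powr \<eta> / 8 \<le> real n / (8 * 2 ^ Q n)"
          by (simp add: field_simps)
        then show ?thesis using 1 by (intro mult_mono) auto
      qed
      ultimately show ?case by (simp add: err_def)
    qed
    show "(\<lambda>n. 1 - err n) \<longlonglongrightarrow> 1"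
      unfolding err_def L_def using \<eta> by real_asymp
  qed auto
  ultimately show ?thesis by blast
qed

end
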